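(* Let $X\ne\{0\}$ be a complex Banach space with open unit ball $B_X$. Let $k,m\in\mathbb{N}$ and $p\in(0,2]$, and let $R_1=R^p_{k,m}$ be the unique root in $(0,1)$ of the equation $$\frac{r^k}{1-r^k}+\frac{r^m}{1-r^m}-\frac p2=0 .$$ Let $f:B_X\to\mathbb{D}$ be holomorphic with homogeneous polynomial expansion $f(z)=\sum_{j=0}^\infty P_j(z)$, $z\in B_X$, and $a=|f(0)|$. For $n\in\mathbb{N}$ let $\mu_n:B_X\to B_X$ be a Schwarz mapping having a zero of order $n$ at $z=0$. Then $$G_f(z):=a^p+\sum_{j=1}^\infty|P_j(\mu_k(z))|+\Big(\frac1{1+a}+\frac{r^k}{1-r^k}\Big)\sum_{j=1}^\infty|P_j(\mu_k(z))|^2+|f(\mu_m(z))-f(0)|\le1$$ for $\|z\|=r\le R_1$. The number $R_1$ is best possible: for every $R\in(R_1,1)$ there exist such $f$ and $\mu_n$ ($n\ge 1$) and a point $z\in B_X$ with $\|z\|=r\le R$ such that $G_f(z)>1$.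
   Context: $\mathbb{N}=\{1,2,\dots\}$ and $\mathbb{D}=\{z\in\mathbb{C}:|z|<1\}$. A homogeneous polynomial of degree $j$ on $X$ is a map $P_j(x)=u(x,\dots,x)$ for a (continuous) $j$-linear map $u$ on $X^j$; $P_0$ is the constant $f(0)$. Every holomorphic $f:B_X\to\mathbb{D}$ has a unique expansion $f(z)=\sum_{j\ge0}P_j(z)$ on $B_X$ with $P_j$ homogeneous of degree $j$. A Schwarz mapping is a holomorphic map $\mu:B_X\to B_X$ with $\mu(0)=0$; it has a zero of order $n$ at $0$ if the first non-zero term of its homogeneous polynomial expansion at $0$ has degree $n$. *)

theory Defs
  imports "HOL-Analysis.Analysis"
begin

class complex_normed_vector = real_normed_vector +
  fixes scaleC :: "complex \<Rightarrow> 'a \<Rightarrow> 'a"  (infixr \<open>*\<^sub>C\<close> 75)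
  assumes scaleC_add_right: "c *\<^sub>C (x + y) = c *\<^sub>C x + c *\<^sub>C y"
    and scaleC_add_left: "(c + d) *\<^sub>C x = c *\<^sub>C x + d *\<^sub>C x"
    and scaleC_scaleC: "c *\<^sub>C d *\<^sub>C x = (c * d) *\<^sub>C x"
    and scaleR_scaleC: "r *\<^sub>R x = complex_of_real r *\<^sub>C x"
    and norm_scaleC: "norm (c *\<^sub>C x) = cmod c * norm x"

class complex_banach = complex_normed_vector + banach

instantiation complex :: complex_banach
begin

definition scaleC_complex :: "complex \<Rightarrow> complex \<Rightarrow> complex"
  where "scaleC_complex c x = c * x"

instance
  by standard (auto simp: scaleC_complex_def algebra_simps scaleR_conv_of_real norm_mult)

end

(* Complex Frechet differentiability at every point; meant for open S. *)
definition holomorphic_map_on ::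
    "('a::complex_normed_vector \<Rightarrow> 'b::complex_normed_vector) \<Rightarrow> 'a set \<Rightarrow> bool"
  where "holomorphic_map_on f S \<longleftrightarrow>
    (\<forall>x\<in>S. \<exists>D. (f has_derivative D) (at x) \<and> (\<forall>c v. D (c *\<^sub>C v) = c *\<^sub>C D v))"

(* A j-tuple of vectors is a sequence of which only the entries with index below j matter.
   For such u, continuity in the product topology on sequences is continuity on the j-fold
   product. *)
definition multilinear_map ::
    "nat \<Rightarrow> ((nat \<Rightarrow> 'a::complex_normed_vector) \<Rightarrow> 'b::complex_normed_vector) \<Rightarrow> bool"
  where "multilinear_map j u \<longleftrightarrow>
    (\<forall>x y. (\<forall>i<j. x i = y i) \<longrightarrow> u x = u y) \<and>
    (\<forall>i<j. \<forall>x a b. u (x(i := a + b)) = u (x(i := a)) + u (x(i := b))) \<and>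
    (\<forall>i<j. \<forall>x c a. u (x(i := c *\<^sub>C a)) = c *\<^sub>C u (x(i := a)))"

definition homogeneous_polynomial ::
    "nat \<Rightarrow> ('a::complex_normed_vector \<Rightarrow> 'b::complex_normed_vector) \<Rightarrow> bool"
  where "homogeneous_polynomial j P \<longleftrightarrow>
    (\<exists>u. multilinear_map j u \<and> continuous_on UNIV u \<and> (\<forall>x. P x = u (\<lambda>_. x)))"

definition homogeneous_expansion ::
    "('a::complex_normed_vector \<Rightarrow> 'b::complex_normed_vector) \<Rightarrow> (nat \<Rightarrow> 'a \<Rightarrow> 'b) \<Rightarrow> bool"
  where "homogeneous_expansion f P \<longleftrightarrow>
    (\<forall>j. homogeneous_polynomial j (P j)) \<and> (\<forall>z\<in>ball 0 1. (\<lambda>j. P j z) sums f z)"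

definition schwarz_mapping :: "('a::complex_normed_vector \<Rightarrow> 'a) \<Rightarrow> bool"
  where "schwarz_mapping \<mu> \<longleftrightarrow>
    holomorphic_map_on \<mu> (ball 0 1) \<and> \<mu> ` ball 0 1 \<subseteq> ball 0 1 \<and> \<mu> 0 = 0"

definition zero_of_order ::
    "('a::complex_normed_vector \<Rightarrow> 'b::complex_normed_vector) \<Rightarrow> nat \<Rightarrow> bool"
  where "zero_of_order \<mu> n \<longleftrightarrow>
    (\<exists>Q. homogeneous_expansion \<mu> Q \<and> (\<forall>j<n. \<forall>x. Q j x = 0) \<and> (\<exists>x. Q n x \<noteq> 0))"

definition is_bohr_root :: "real \<Rightarrow> nat \<Rightarrow> nat \<Rightarrow> real \<Rightarrow> bool"
  where "is_bohr_root p k m r \<longleftrightarrow>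
    0 < r \<and> r < 1 \<and> r ^ k / (1 - r ^ k) + r ^ m / (1 - r ^ m) - p / 2 = 0"

definition bohr_radius :: "real \<Rightarrow> nat \<Rightarrow> nat \<Rightarrow> real"
  where "bohr_radius p k m = (THE r. is_bohr_root p k m r)"

definition bohr_data ::
    "('a::complex_normed_vector \<Rightarrow> complex) \<Rightarrow> (nat \<Rightarrow> 'a \<Rightarrow> complex) \<Rightarrow> (nat \<Rightarrow> 'a \<Rightarrow> 'a) \<Rightarrow> bool"
  where "bohr_data f P \<mu> \<longleftrightarrow>
    holomorphic_map_on f (ball 0 1) \<and> f ` ball 0 1 \<subseteq> ball 0 1 \<and>
    homogeneous_expansion f P \<and>
    (\<forall>n\<ge>1. schwarz_mapping (\<mu> n) \<and> zero_of_order (\<mu> n) n)"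

(* Both series start at degree 1. *)
definition bohr_G ::
    "real \<Rightarrow> nat \<Rightarrow> nat \<Rightarrow> ('a::complex_normed_vector \<Rightarrow> complex) \<Rightarrow> (nat \<Rightarrow> 'a \<Rightarrow> complex) \<Rightarrow>
     (nat \<Rightarrow> 'a \<Rightarrow> 'a) \<Rightarrow> 'a \<Rightarrow> real"
  where "bohr_G p k m f P \<mu> z =
    (let a = cmod (f 0); r = norm z in
      a powr p + (\<Sum>j. cmod (P (Suc j) (\<mu> k z))) +
      (1 / (1 + a) + r ^ k / (1 - r ^ k)) * (\<Sum>j. (cmod (P (Suc j) (\<mu> k z)))\<^sup>2) +
      cmod (f (\<mu> m z) - f 0))"

(* Rules out that the sums in bohr_G take an arbitrary value because of divergence. *)
definition bohr_G_converges ::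
    "nat \<Rightarrow> (nat \<Rightarrow> 'a::complex_normed_vector \<Rightarrow> complex) \<Rightarrow> (nat \<Rightarrow> 'a \<Rightarrow> 'a) \<Rightarrow> 'a \<Rightarrow> bool"
  where "bohr_G_converges k P \<mu> z \<longleftrightarrow>
    summable (\<lambda>j. cmod (P (Suc j) (\<mu> k z))) \<and>
    summable (\<lambda>j. (cmod (P (Suc j) (\<mu> k z)))\<^sup>2)"

end

theory Submission
  imports Defs "HOL-Complex_Analysis.Complex_Analysis"
begin

text \<open>
  Let $c_j$ be the coefficients of a power series bounded by 1 on the unit disc. Averaging over
  roots of unity shows that its lower triangular Toeplitz form is a contraction, and suitable test
  vectors give Carlson's inequalities for $|c_{2n+1}|$ and $|c_{2n}|$. Summed against $\rho^j$, these
  turn into the refined Bohr inequality with right-hand side $(1-|c_0|^2)\rho/(1-\rho)$. On complex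
  lines through 0, the Schwarz lemma $\|\mu_n(z)\| \le \|z\|^n$ lets it be applied with
  $\rho = r^k$ and $\rho = r^m$, so $G_f$ is at most
  $a^p + (1-a^2)(r^k/(1-r^k) + r^m/(1-r^m)) \le a^p + (1-a^2)p/2 \le 1$.

  For sharpness, a norming functional $\psi$ gives $f = (a-\psi)/(1-a\psi)$ and
  $\mu_n(x) = \psi(x)^{n-1}x$; the resulting lower bound for $G_f$ equals 1 at $a = 1$ and has
  negative derivative there once $r$ exceeds the Bohr radius.
\<close>

section \<open>Coefficients of bounded power series\<close>

text \<open>The weight of the squares in G_f is dictated by Carlson's inequalities. They bound
  |c_N|, N > 0, by 1 minus all |c_j|^2 with 2j < N, minus |c_j|^2/(1+|c_0|) if 2j = N. Multiplied by
  \<rho>^N and summed over N, the square |c_j|^2 with j > 0 is subtracted with \<rho>^(2j)/(1+|c_0|)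
  from N = 2j and with \<rho>^(2j) \<rho>/(1-\<rho>) from all N > 2j: this is exactly the weighted
  square sum of G_f. The terms with j = 0 leave (1-|c_0|^2)\<rho>/(1-\<rho>). Finite Toeplitz
  sections sampled at roots of unity avoid boundary values of functions in the disc. Norming
  functionals serve twice: they make the Schwarz lemma for X-valued maps scalar, and they supply
  extremal maps in every nonzero X.\<close>

definition bounded_power_series :: "(nat \<Rightarrow> complex) \<Rightarrow> bool"
  where "bounded_power_series c \<longleftrightarrow>
    (\<forall>z. norm z < 1 \<longrightarrow> summable (\<lambda>j. c j * z ^ j) \<and> norm (\<Sum>j. c j * z ^ j) \<le> 1)"

section \<open>Roots of unity and Toeplitz forms\<close>

lemma sum_roots_unity_orthogonal:
  fixes M a b :: nat
  assumes "a < M" "b < M"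
  defines "\<omega> \<equiv> \<lambda>t. cis (2 * pi * real t / real M)"
  shows "(\<Sum>t<M. \<omega> t ^ a * cnj (\<omega> t) ^ b) = (if a = b then of_nat M else 0)"
proof -
  have M: "M > 0" using assms by simp
  \<comment> \<open>Exponent and sample index can be exchanged, so the \<open>t\<close>-th summand
    is \<open>q ^ t\<close> and the sum is geometric; \<open>a, b < M\<close> excludes
    \<open>q = 1\<close> for distinct exponents.\<close>
  define q where "q = \<omega> a * cnj (\<omega> b)"
  have eq: "\<omega> t ^ a * cnj (\<omega> t) ^ b = q ^ t" for t
  proof -
    have "\<omega> t ^ a * cnj (\<omega> t) ^ b
      = cis (real a * (2 * pi * real t / real M) + real b * - (2 * pi * real t / real M))"
      by (simp only: \<omega>_def cis_cnj Complex.DeMoivre cis_mult)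
    also have "\<dots> = cis (real t * (2 * pi * real a / real M + - (2 * pi * real b / real M)))"
      by (rule arg_cong[of _ _ cis]) (simp add: algebra_simps)
    also have "\<dots> = q ^ t"
      by (simp only: \<omega>_def q_def cis_cnj Complex.DeMoivre cis_mult)
    finally show ?thesis .
  qed
  have qM: "q ^ M = 1"
  proof -
    have "\<omega> a ^ M = 1" "\<omega> b ^ M = 1"
      using bij_betw_apply[OF Complex.bij_betw_roots_unity[OF M]] assms by (auto simp: \<omega>_def)
    then show ?thesis by (simp add: q_def power_mult_distrib flip: complex_cnj_power)
  qed
  show ?thesis
  proof (cases "a = b")
    case True
    then have "q = 1" by (simp add: q_def \<omega>_def cis_cnj cis_mult)
    then show ?thesis using True unfolding eq by simp
  next
    case False
    have "\<omega> a \<noteq> \<omega> b"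
      using Complex.bij_betw_roots_unity[OF M] assms False
      unfolding \<omega>_def bij_betw_def inj_on_def by blast
    moreover have "q * \<omega> b = \<omega> a" by (simp add: q_def \<omega>_def cis_cnj cis_mult)
    ultimately have "q \<noteq> 1" by auto
    then show ?thesis using False qM unfolding eq by (simp add: geometric_sum)
  qed
qed

text \<open>The form is the average of \<open>p * pol u * cnj (pol v)\<close> over the
  \<open>M\<close>-th roots of unity. There \<open>p\<close> is bounded by \<open>B\<close>, the
  other two factors by their mean square, and Parseval holds on the same nodes. A mean of squares
  instead of a product of norms loses nothing later, since the test vectors have equal
  norms.\<close>

lemma toeplitz_form_polynomial:
  fixes c u v :: "nat \<Rightarrow> complex"
  assumes L: "N < L" and B: "\<And>z. norm z = 1 \<Longrightarrow> norm (\<Sum>l<L. c l * z ^ l) \<le> B"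
  shows "Re (\<Sum>j\<le>N. \<Sum>i\<le>j. u i * c (j - i) * cnj (v j))
    \<le> B / 2 * ((\<Sum>i\<le>N. (norm (u i))\<^sup>2) + (\<Sum>i\<le>N. (norm (v i))\<^sup>2))"
proof -
  \<comment> \<open>All exponents \<open>l + i\<close> and \<open>j\<close> stay below
    \<open>M\<close>, so sampling causes no aliasing.\<close>
  define M where "M = L + N + 1"
  have M: "l < L \<Longrightarrow> i \<le> N \<Longrightarrow> l + i < M" "i \<le> N \<Longrightarrow> i < M" for l i
    by (auto simp: M_def)
  define \<omega> where "\<omega> = (\<lambda>t. cis (2 * pi * real t / real M))"
  have orth: "a < M \<Longrightarrow> b < M \<Longrightarrow>
      (\<Sum>t<M. \<omega> t ^ a * cnj (\<omega> t) ^ b) = (if a = b then of_nat M else 0)" for a b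
    unfolding \<omega>_def by (rule sum_roots_unity_orthogonal)
  define p where "p = (\<lambda>z. \<Sum>l<L. c l * z ^ l)"
  define pol where "pol = (\<lambda>w z. \<Sum>i\<le>N. w i * z ^ i :: complex)"
  have parseval: "(\<Sum>t<M. (norm (pol w (\<omega> t)))\<^sup>2) = M * (\<Sum>i\<le>N. (norm (w i))\<^sup>2)" for w
  proof -
    have "complex_of_real (\<Sum>t<M. (norm (pol w (\<omega> t)))\<^sup>2)
      = (\<Sum>t<M. pol w (\<omega> t) * cnj (pol w (\<omega> t)))"
      by (simp only: of_real_sum complex_norm_square)
    also have "\<dots> = (\<Sum>t<M. \<Sum>i\<le>N. \<Sum>j\<le>N. w i * cnj (w j) * (\<omega> t ^ i * cnj (\<omega> t) ^ j))"
      by (simp add: pol_def sum_product mult_ac)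
    also have "\<dots> = (\<Sum>i\<le>N. \<Sum>j\<le>N. \<Sum>t<M. w i * cnj (w j) * (\<omega> t ^ i * cnj (\<omega> t) ^ j))"
      by (rule trans[OF sum.swap], rule sum.cong[OF refl], rule sum.swap)
    also have "\<dots> = (\<Sum>i\<le>N. \<Sum>j\<le>N. w i * cnj (w j) * (if i = j then of_nat M else 0))"
      by (intro sum.cong refl) (simp add: sum_distrib_left[symmetric] orth M)
    also have "\<dots> = (\<Sum>i\<le>N. w i * cnj (w i) * of_nat M)"
      by (intro sum.cong refl) (simp add: if_distrib[of "\<lambda>x. _ * x"] sum.delta cong: if_cong)
    also have "\<dots> = complex_of_real (M * (\<Sum>i\<le>N. (norm (w i))\<^sup>2))"
      unfolding of_real_mult of_real_sum complex_norm_square sum_distrib_left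
      by (simp add: mult_ac)
    finally show ?thesis using of_real_eq_iff by blast
  qed
  have "(\<Sum>t<M. p (\<omega> t) * pol u (\<omega> t) * cnj (pol v (\<omega> t)))
    = (\<Sum>t<M. \<Sum>j\<le>N. \<Sum>i\<le>N. \<Sum>l<L. u i * c l * cnj (v j) * (\<omega> t ^ (l + i) * cnj (\<omega> t) ^ j))"
  proof (intro sum.cong refl)
    fix t
    have "p (\<omega> t) * pol u (\<omega> t) * cnj (pol v (\<omega> t))
      = cnj (pol v (\<omega> t)) * (pol u (\<omega> t) * p (\<omega> t))"
      by (simp only: mult_ac)
    also have "\<dots> = (\<Sum>j\<le>N. \<Sum>i\<le>N. \<Sum>l<L. (cnj (v j) * cnj (\<omega> t) ^ j) * ((u i * \<omega> t ^ i) * (c l * \<omega> t ^ l)))"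
      unfolding p_def pol_def
      by (simp only: cnj_sum complex_cnj_mult complex_cnj_power sum_product)
         (simp only: sum_distrib_left)
    also have "\<dots> = (\<Sum>j\<le>N. \<Sum>i\<le>N. \<Sum>l<L. u i * c l * cnj (v j) * (\<omega> t ^ (l + i) * cnj (\<omega> t) ^ j))"
      by (intro sum.cong refl) (simp add: power_add mult_ac)
    finally show "p (\<omega> t) * pol u (\<omega> t) * cnj (pol v (\<omega> t)) = \<dots>" .
  qed
  also have "\<dots> = (\<Sum>j\<le>N. \<Sum>i\<le>N. \<Sum>l<L. \<Sum>t<M. u i * c l * cnj (v j) * (\<omega> t ^ (l + i) * cnj (\<omega> t) ^ j))"
    by (rule trans[OF sum.swap], rule sum.cong[OF refl], rule trans[OF sum.swap], rule sum.cong[OF refl], rule sum.swap)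
  also have "\<dots> = (\<Sum>j\<le>N. \<Sum>i\<le>N. \<Sum>l<L. if l + i = j then u i * c l * cnj (v j) * of_nat M else 0)"
    by (intro sum.cong refl) (simp add: sum_distrib_left[symmetric] orth M)
  also have "\<dots> = (\<Sum>j\<le>N. \<Sum>i\<le>j. u i * c (j - i) * cnj (v j) * of_nat M)"
  proof (rule sum.cong[OF refl])
    fix j assume j: "j \<in> {..N}"
    have "(\<Sum>l<L. if l + i = j then u i * c l * cnj (v j) * of_nat M else 0)
      = (if i \<le> j then u i * c (j - i) * cnj (v j) * of_nat M else 0)" for i
    proof (cases "i \<le> j")
      case True
      have "(\<Sum>l<L. if l + i = j then u i * c l * cnj (v j) * of_nat M else 0)
        = (\<Sum>l<L. if l = j - i then u i * c l * cnj (v j) * of_nat M else 0)"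
        using True by (intro sum.cong) auto
      then show ?thesis using True j L by (simp add: sum.delta)
    qed (auto intro!: sum.neutral)
    then have "(\<Sum>i\<le>N. \<Sum>l<L. if l + i = j then u i * c l * cnj (v j) * of_nat M else 0)
      = (\<Sum>i\<le>N. if i \<in> {..j} then u i * c (j - i) * cnj (v j) * of_nat M else 0)"
      by simp
    also have "\<dots> = (\<Sum>i\<in>{..N} \<inter> {..j}. u i * c (j - i) * cnj (v j) * of_nat M)"
      by (subst sum.inter_restrict) auto
    also have "\<dots> = (\<Sum>i\<le>j. u i * c (j - i) * cnj (v j) * of_nat M)"
      using j by (intro sum.cong) auto
    finally show "(\<Sum>i\<le>N. \<Sum>l<L. if l + i = j then u i * c l * cnj (v j) * of_nat M else 0)
      = (\<Sum>i\<le>j. u i * c (j - i) * cnj (v j) * of_nat M)" .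
  qed
  finally have main: "M * Re (\<Sum>j\<le>N. \<Sum>i\<le>j. u i * c (j - i) * cnj (v j))
      = Re (\<Sum>t<M. p (\<omega> t) * pol u (\<omega> t) * cnj (pol v (\<omega> t)))"
    by (simp flip: sum_distrib_right)
  have B0: "B \<ge> 0" using order_trans[OF norm_ge_zero B[of 1]] by simp
  have "Re (p (\<omega> t) * pol u (\<omega> t) * cnj (pol v (\<omega> t)))
    \<le> B / 2 * ((norm (pol u (\<omega> t)))\<^sup>2 + (norm (pol v (\<omega> t)))\<^sup>2)" for t
  proof -
    have "Re (p (\<omega> t) * pol u (\<omega> t) * cnj (pol v (\<omega> t)))
      \<le> norm (p (\<omega> t)) * (norm (pol u (\<omega> t)) * norm (pol v (\<omega> t)))"
      using complex_Re_le_cmod[of "p (\<omega> t) * pol u (\<omega> t) * cnj (pol v (\<omega> t))"]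
      by (simp add: norm_mult mult_ac)
    also have "\<dots> \<le> B * (((norm (pol u (\<omega> t)))\<^sup>2 + (norm (pol v (\<omega> t)))\<^sup>2) / 2)"
    proof (intro mult_mono B0)
      show "norm (p (\<omega> t)) \<le> B" unfolding p_def by (rule B) (simp add: \<omega>_def)
      show "norm (pol u (\<omega> t)) * norm (pol v (\<omega> t))
          \<le> ((norm (pol u (\<omega> t)))\<^sup>2 + (norm (pol v (\<omega> t)))\<^sup>2) / 2"
        using sum_squares_bound[of "norm (pol u (\<omega> t))" "norm (pol v (\<omega> t))"] by simp
    qed auto
    finally show ?thesis by simp
  qed
  then have "M * Re (\<Sum>j\<le>N. \<Sum>i\<le>j. u i * c (j - i) * cnj (v j))
    \<le> (\<Sum>t<M. B / 2 * ((norm (pol u (\<omega> t)))\<^sup>2 + (norm (pol v (\<omega> t)))\<^sup>2))"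
    unfolding main unfolding Re_sum by (intro sum_mono)
  also have "\<dots> = M * (B / 2 * ((\<Sum>i\<le>N. (norm (u i))\<^sup>2) + (\<Sum>i\<le>N. (norm (v i))\<^sup>2)))"
    unfolding sum_distrib_left[symmetric] sum.distrib parseval by (simp add: algebra_simps)
  finally show ?thesis by (simp add: M_def)
qed

text \<open>The series need not converge on the unit circle. Its dilation by \<open>s < 1\<close>
  converges absolutely there and has long partial sums bounded by \<open>1 + e\<close>, so the
  polynomial case applies; then \<open>e\<close> tends to 0 and \<open>s\<close> to 1. The condition
  \<open>N < L\<close> keeps every coefficient of the form in the partial sum.\<close>

lemma toeplitz_form_bounded:
  fixes c u v :: "nat \<Rightarrow> complex"
  assumes c: "bounded_power_series c"
  shows "Re (\<Sum>j\<le>N. \<Sum>i\<le>j. u i * c (j - i) * cnj (v j))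
    \<le> ((\<Sum>i\<le>N. (norm (u i))\<^sup>2) + (\<Sum>i\<le>N. (norm (v i))\<^sup>2)) / 2" (is "_ \<le> ?W / 2")
proof -
  let ?S = "\<lambda>s. Re (\<Sum>j\<le>N. \<Sum>i\<le>j. u i * (c (j - i) * of_real s ^ (j - i)) * cnj (v j))"
  have W: "?W \<ge> 0" by (simp add: sum_nonneg)
  have eps: "?S s \<le> (1 + e) / 2 * ?W" if s: "0 < s" "s < 1" and e: "e > 0" for s e :: real
  proof -
    \<comment> \<open>Convergence at an intermediate radius gives absolute convergence at
      \<open>s\<close>.\<close>
    define s' where "s' = (s + 1) / 2"
    have s': "s < s'" "s' < 1" using s by (auto simp: s'_def)
    have "summable (\<lambda>j. c j * complex_of_real s' ^ j)"
      using c s s' by (auto simp: bounded_power_series_def)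
    then have sm: "summable (\<lambda>j. norm (c j * complex_of_real s ^ j))"
      by (rule powser_insidea) (use s s' in auto)
    then have "(\<lambda>n. suminf (\<lambda>i. norm (c (i + n) * complex_of_real s ^ (i + n)))) \<longlonglongrightarrow> 0"
      using suminf_exist_split2 by blast
    then have "\<forall>\<^sub>F n in sequentially. (\<Sum>i. norm (c (i + n) * complex_of_real s ^ (i + n))) < e"
      using e order_tendstoD(2) by blast
    then have "\<forall>\<^sub>F n in sequentially. N < n \<and> (\<Sum>i. norm (c (i + n) * complex_of_real s ^ (i + n))) < e"
      using eventually_gt_at_top eventually_conj by blast
    then obtain L where L: "N < L" "(\<Sum>i. norm (c (i + L) * complex_of_real s ^ (i + L))) < e"
      using eventually_happens' sequentially_bot by blast
    show ?thesis
    proof (rule toeplitz_form_polynomial[OF L(1)])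
      fix z :: complex assume z: "norm z = 1"
      let ?g = "\<lambda>j. c j * (of_real s * z) ^ j"
      have ng: "norm (?g j) = norm (c j * complex_of_real s ^ j)" for j
        using z by (simp add: norm_mult norm_power)
      have smg: "summable (\<lambda>j. norm (?g j))" using sm ng by simp
      have "norm (\<Sum>l. ?g (l + L)) \<le> (\<Sum>l. norm (?g (l + L)))"
        by (rule summable_norm) (use smg in \<open>subst summable_iff_shift\<close>)
      also have "\<dots> < e" using L(2) unfolding ng .
      finally have tail: "norm (\<Sum>l. ?g (l + L)) < e" .
      have "norm (suminf ?g) \<le> 1"
        using c s z unfolding bounded_power_series_def by (simp add: norm_mult)
      moreover have "suminf ?g = (\<Sum>l. ?g (l + L)) + (\<Sum>l<L. ?g l)"
        by (rule suminf_split_initial_segment) (rule summable_norm_cancel[OF smg])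
      moreover have "(\<Sum>l<L. c l * of_real s ^ l * z ^ l) = (\<Sum>l<L. ?g l)"
        by (simp add: power_mult_distrib mult_ac)
      ultimately show "norm (\<Sum>l<L. c l * of_real s ^ l * z ^ l) \<le> 1 + e"
        using tail norm_triangle_ineq4[of "suminf ?g" "\<Sum>l. ?g (l + L)"] by simp
    qed
  qed
  have le: "?S s \<le> ?W / 2" if s: "0 < s" "s < 1" for s
  proof (rule tendsto_lowerbound)
    show "((\<lambda>e. (1 + e) / 2 * ?W) \<longlongrightarrow> ?W / 2) (at_right 0)"
      by (auto intro!: tendsto_eq_intros)
    show "\<forall>\<^sub>F e in at_right 0. ?S s \<le> (1 + e) / 2 * ?W"
      using eps[OF s] by (auto simp: eventually_at_right_less eventually_at_filter)
  qed auto
  show ?thesis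
  proof (rule tendsto_upperbound)
    have "(?S \<longlongrightarrow> Re (\<Sum>j\<le>N. \<Sum>i\<le>j. u i * (c (j - i) * of_real 1 ^ (j - i)) * cnj (v j))) (at_left 1)"
      by (intro tendsto_intros)
    then show "(?S \<longlongrightarrow> Re (\<Sum>j\<le>N. \<Sum>i\<le>j. u i * c (j - i) * cnj (v j))) (at_left 1)" by simp
    have "\<forall>\<^sub>F s in at_left (1::real). s \<in> {0<..<1}"
      by (rule eventually_at_left_real) simp
    then show "\<forall>\<^sub>F s in at_left 1. ?S s \<le> ?W / 2"
      by eventually_elim (use le in auto)
  qed auto
qed

section \<open>Carlson's inequalities\<close>

text \<open>The test vectors of the Toeplitz form are the unit vectors at 0 and at \<open>N\<close>, perturbed by the
  weighted coefficients; the phase \<open>\<epsilon>\<close> makes the leading term equal to \<open>norm (c N)\<close>. In \<open>carlson\<close>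
  the middle weight is chosen to maximise \<open>2 * w - (1 + norm (c 0)) * w\<^sup>2\<close>.\<close>
lemma carlson_weighted:
  fixes c :: "nat \<Rightarrow> complex" and w :: "nat \<Rightarrow> real"
  assumes c: "bounded_power_series c" and N: "N > 0" and w: "\<And>j. N < 2 * j \<Longrightarrow> w j = 0"
  shows "norm (c N) + (\<Sum>j\<le>N. (2 * w j - (w j)\<^sup>2 - (if 2 * j = N then norm (c 0) * (w j)\<^sup>2 else 0))
      * (norm (c j))\<^sup>2) \<le> 1"
proof -
  define \<epsilon> where "\<epsilon> = (if c N = 0 then 1 else sgn (c N))"
  have "c N * cnj (sgn (c N)) = of_real (norm (c N))"
  proof (cases "c N = 0")
    case False
    have "c N * cnj (sgn (c N)) = c N * cnj (c N) / of_real (norm (c N))"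
      by (simp add: sgn_div_norm scaleR_conv_of_real divide_inverse mult_ac)
    also have "\<dots> = of_real (norm (c N))"
      using False by (simp add: power2_eq_square flip: complex_norm_square)
    finally show ?thesis .
  qed simp
  then have \<epsilon>: "norm \<epsilon> = 1" "c N * cnj \<epsilon> = of_real (norm (c N))"
    by (auto simp: \<epsilon>_def norm_sgn)
  have \<epsilon>\<epsilon>: "\<epsilon> * cnj \<epsilon> = 1" using \<epsilon>(1) by (simp flip: complex_norm_square)
  \<comment> \<open>The reversed index pairs each \<open>c (N - i)\<close> with its own conjugate in
    \<open>T N\<close>, so both linear perturbations contribute the same
    \<open>\<sigma>\<close>.\<close>
  define x where "x i = of_real (w (N - i)) * cnj (c (N - i))" for i
  define y where "y j = of_real (w j) * c j" for j
  define u where "u i = (if i = 0 then 1 else 0) + \<epsilon> * x i" for i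
  define v where "v j = (if j = N then \<epsilon> else 0) + y j" for j
  define T where "T j = (\<Sum>i\<le>j. x i * c (j - i))" for j
  define \<sigma> where "\<sigma> = (\<Sum>j\<le>N. w j * (norm (c j))\<^sup>2)"
  \<comment> \<open>Since \<open>w N = 0\<close>, the perturbations vanish where the unit vectors
    sit, and \<open>nu\<close> and \<open>nv\<close> have no cross terms.\<close>
  have x0: "x 0 = 0" and yN: "y N = 0" using w[of N] N by (auto simp: x_def y_def)
  have rev: "(\<Sum>i\<le>N. g (N - i)) = (\<Sum>i\<le>N. g i)" for g :: "nat \<Rightarrow> 'b::comm_monoid_add"
    by (rule sum.reindex_bij_witness[where i="\<lambda>i. N - i" and j="\<lambda>i. N - i"]) auto
  have inner: "(\<Sum>i\<le>j. u i * c (j - i)) = c j + \<epsilon> * T j" for j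
  proof -
    have "(\<Sum>i\<le>j. u i * c (j - i))
        = (\<Sum>i\<le>j. if i = 0 then c (j - i) else 0) + (\<Sum>i\<le>j. \<epsilon> * (x i * c (j - i)))"
      unfolding u_def sum.distrib[symmetric] by (intro sum.cong refl) (auto simp: algebra_simps)
    also have "(\<Sum>i\<le>j. if i = 0 then c (j - i) else 0) = c j"
      by (simp add: sum.delta)
    finally show ?thesis by (simp add: T_def sum_distrib_left)
  qed
  have TN: "T N = of_real \<sigma>"
  proof -
    have "T N = (\<Sum>i\<le>N. of_real (w (N - i) * (norm (c (N - i)))\<^sup>2))"
      unfolding T_def x_def of_real_mult complex_norm_square
      by (intro sum.cong refl) (simp add: mult_ac)
    also have "\<dots> = of_real \<sigma>"
      using rev[of "\<lambda>i. complex_of_real (w i * (norm (c i))\<^sup>2)"] by (simp add: \<sigma>_def)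
    finally show ?thesis .
  qed
  have cy: "(\<Sum>j\<le>N. c j * cnj (y j)) = of_real \<sigma>"
    unfolding \<sigma>_def y_def of_real_sum of_real_mult complex_norm_square
    by (intro sum.cong refl) (simp add: mult_ac)
  \<comment> \<open>\<open>y j\<close> lives on \<open>2 * j \<le> N\<close> and \<open>x i\<close>
    on \<open>N \<le> 2 * i\<close>, while \<open>T j\<close> only uses \<open>i \<le> j\<close>.
    Hence only \<open>i = j = N / 2\<close> survives, with coefficient \<open>c 0\<close>.\<close>
  have Ty: "norm (T j * cnj (y j)) = (if 2 * j = N then norm (c 0) * (w j)\<^sup>2 else 0) * (norm (c j))\<^sup>2"
    for j
  proof -
    have xi: "x i = 0" if "2 * i < N" for i
      using w[of "N - i"] that by (simp add: x_def)
    consider "N < 2 * j" | "2 * j < N" | "2 * j = N" by linarith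
    then show ?thesis
    proof cases
      case 1
      then show ?thesis using w[of j] by (simp add: y_def)
    next
      case 2
      then have "T j = 0" unfolding T_def by (intro sum.neutral) (auto simp: xi)
      then show ?thesis using 2 by simp
    next
      case 3
      have "T j = (\<Sum>i\<in>{j}. x i * c (j - i))"
        unfolding T_def using 3 by (intro sum.mono_neutral_right) (auto simp: xi)
      moreover have "N - j = j" using 3 by simp
      ultimately show ?thesis
        using 3 by (simp add: x_def y_def norm_mult power2_eq_square)
    qed
  qed
  define R where "R = (\<Sum>j\<le>N. T j * cnj (y j))"
  have "(\<Sum>j\<le>N. \<Sum>i\<le>j. u i * c (j - i) * cnj (v j)) = (\<Sum>j\<le>N. (c j + \<epsilon> * T j) * cnj (v j))"
    by (simp add: inner sum_distrib_right[symmetric])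
  also have "\<dots> = (\<Sum>j\<le>N. (if j = N then (c j + \<epsilon> * T j) * cnj \<epsilon> else 0))
      + (\<Sum>j\<le>N. c j * cnj (y j)) + \<epsilon> * R"
    unfolding R_def sum_distrib_left sum.distrib[symmetric] v_def
    by (intro sum.cong refl) (auto simp: algebra_simps)
  also have "(\<Sum>j\<le>N. (if j = N then (c j + \<epsilon> * T j) * cnj \<epsilon> else 0)) = c N * cnj \<epsilon> + \<epsilon> * cnj \<epsilon> * T N"
    by (simp add: sum.delta algebra_simps)
  finally have form: "(\<Sum>j\<le>N. \<Sum>i\<le>j. u i * c (j - i) * cnj (v j))
      = of_real (norm (c N) + 2 * \<sigma>) + \<epsilon> * R"
    by (simp add: \<epsilon> \<epsilon>\<epsilon> TN cy)
  define \<tau> where "\<tau> = (\<Sum>j\<le>N. (w j)\<^sup>2 * (norm (c j))\<^sup>2)"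
  have nu: "(\<Sum>i\<le>N. (norm (u i))\<^sup>2) = 1 + \<tau>"
  proof -
    have "(\<Sum>i\<le>N. (norm (u i))\<^sup>2)
        = (\<Sum>i\<le>N. (if i = 0 then 1 else 0) + (w (N - i))\<^sup>2 * (norm (c (N - i)))\<^sup>2)"
      using x0 w[of N] N
      by (intro sum.cong refl) (auto simp: u_def x_def norm_mult \<epsilon> power_mult_distrib)
    then show ?thesis
      using rev[of "\<lambda>i. (w i)\<^sup>2 * (norm (c i))\<^sup>2"] by (simp add: sum.distrib sum.delta \<tau>_def)
  qed
  have nv: "(\<Sum>i\<le>N. (norm (v i))\<^sup>2) = 1 + \<tau>"
  proof -
    have "(\<Sum>i\<le>N. (norm (v i))\<^sup>2)
        = (\<Sum>i\<le>N. (if i = N then 1 else 0) + (w i)\<^sup>2 * (norm (c i))\<^sup>2)"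
      using yN w[of N] N
      by (intro sum.cong refl) (auto simp: v_def y_def norm_mult \<epsilon> power_mult_distrib)
    then show ?thesis by (simp add: sum.distrib sum.delta \<tau>_def)
  qed
  have "norm R \<le> (\<Sum>j\<le>N. (if 2 * j = N then norm (c 0) * (w j)\<^sup>2 else 0) * (norm (c j))\<^sup>2)"
    unfolding R_def Ty[symmetric] by (rule norm_sum)
  moreover have "Re (\<epsilon> * R) \<ge> - norm R"
    using abs_Re_le_cmod[of "\<epsilon> * R"] by (simp add: norm_mult \<epsilon>)
  moreover have "norm (c N) + 2 * \<sigma> + Re (\<epsilon> * R) \<le> 1 + \<tau>"
    using toeplitz_form_bounded[OF c, where N=N and u=u and v=v] unfolding form nu nv by simp
  ultimately show ?thesis
    unfolding \<sigma>_def \<tau>_def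
    by (simp add: left_diff_distrib sum_subtractf sum_distrib_left mult.assoc)
qed

lemma carlson:
  assumes c: "bounded_power_series c" and N: "N > 0"
  shows "norm (c N) + (\<Sum>j\<le>N. (if 2 * j < N then 1 else if 2 * j = N then 1 / (1 + norm (c 0)) else 0)
      * (norm (c j))\<^sup>2) \<le> 1"
proof -
  define w where "w j = (if 2 * j < N then 1 else if 2 * j = N then 1 / (1 + norm (c 0)) else 0)" for j
  have pos: "1 + norm (c 0) > 0" by (smt (verit) norm_ge_zero)
  \<comment> \<open>Each nonzero weight maximises its quadratic, and the maximum equals the
    maximiser: 2w - Aw^2 is 1/A at w = 1/A.\<close>
  have *: "2 * w j - (w j)\<^sup>2 - (if 2 * j = N then norm (c 0) * (w j)\<^sup>2 else 0) = w j" for j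
    using pos by (auto simp: w_def power2_eq_square divide_simps)
  then have "norm (c N) + (\<Sum>j\<le>N. w j * (norm (c j))\<^sup>2) \<le> 1"
    using carlson_weighted[OF c N, of w] by (simp only: *) (simp add: w_def)
  then show ?thesis by (simp only: w_def)
qed

lemma carlson_odd:
  assumes "bounded_power_series c"
  shows "norm (c (2 * n + 1)) \<le> 1 - (\<Sum>j<Suc n. (norm (c j))\<^sup>2)"
proof -
  have "(\<Sum>j<Suc n. (norm (c j))\<^sup>2) = (\<Sum>j\<le>2 * n + 1.
      (if 2 * j < 2 * n + 1 then 1 else if 2 * j = 2 * n + 1 then 1 / (1 + norm (c 0)) else 0)
      * (norm (c j))\<^sup>2)"
    by (rule sum.mono_neutral_cong_left) auto
  then show ?thesis using carlson[OF assms, of "2 * n + 1"] by linarith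
qed

lemma carlson_even:
  assumes "bounded_power_series c" and "n > 0"
  shows "norm (c (2 * n)) \<le> 1 - (\<Sum>j<n. (norm (c j))\<^sup>2) - (norm (c n))\<^sup>2 / (1 + norm (c 0))"
proof -
  have "(\<Sum>j<n. (norm (c j))\<^sup>2) + (norm (c n))\<^sup>2 / (1 + norm (c 0))
    = (\<Sum>j<Suc n. (if j < n then 1 else 1 / (1 + norm (c 0))) * (norm (c j))\<^sup>2)"
    by simp
  also have "\<dots> = (\<Sum>j\<le>2 * n.
      (if 2 * j < 2 * n then 1 else if 2 * j = 2 * n then 1 / (1 + norm (c 0)) else 0)
      * (norm (c j))\<^sup>2)"
    by (rule sum.mono_neutral_cong_left) auto
  finally show ?thesis using carlson[OF assms(1), of "2 * n"] assms(2) by linarith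
qed

section \<open>The refined Bohr inequality\<close>

text \<open>The subtracted term is what Carlson's bounds leave for the tail; it makes the induction step
  an identity in \<open>D\<close> and \<open>b\<close>.\<close>
lemma refined_bohr_partial:
  fixes c :: "nat \<Rightarrow> complex"
  assumes c: "bounded_power_series c" and \<rho>: "0 \<le> \<rho>" "\<rho> < 1"
  defines "a \<equiv> norm (c 0)"
  shows "(\<Sum>j=1..2 * n. norm (c j) * \<rho> ^ j)
      + (1 / (1 + a) + \<rho> / (1 - \<rho>)) * (\<Sum>j=1..n. (norm (c j) * \<rho> ^ j)\<^sup>2)
    \<le> (1 - a\<^sup>2) * \<rho> / (1 - \<rho>) - (1 - (\<Sum>j<Suc n. (norm (c j))\<^sup>2)) * \<rho> ^ (2 * n + 1) / (1 - \<rho>)"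
proof (induction n)
  case 0
  then show ?case by (simp add: a_def)
next
  case (Suc n)
  define D where "D = 1 - (\<Sum>j<Suc n. (norm (c j))\<^sup>2)"
  define b where "b = (norm (c (Suc n)))\<^sup>2"
  define q where "q = \<rho> ^ (2 * n + 1)"
  define \<kappa> where "\<kappa> = 1 / (1 + a)"
  have q0: "q \<ge> 0" using \<rho> by (simp add: q_def)
  have \<rho>0: "1 - \<rho> \<noteq> 0" using \<rho> by simp
  have 1: "norm (c (2 * n + 1)) \<le> D"
    using carlson_odd[OF c, of n] by (simp add: D_def)
  have 2: "norm (c (2 * n + 2)) \<le> D - \<kappa> * b"
    using carlson_even[OF c, of "Suc n"] by (simp add: D_def \<kappa>_def b_def a_def)
  have s1: "(\<Sum>j=1..2 * Suc n. norm (c j) * \<rho> ^ j)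
    = (\<Sum>j=1..2 * n. norm (c j) * \<rho> ^ j) + norm (c (2 * n + 1)) * q + norm (c (2 * n + 2)) * (q * \<rho>)"
    by (simp add: q_def mult_ac)
  \<comment> \<open>The square of index \<open>n + 1\<close> carries the same power of
    \<open>\<rho>\<close> as the coefficient of index \<open>2 * n + 2\<close>; this is why two
    coefficients are added per square.\<close>
  have s2: "(\<Sum>j=1..Suc n. (norm (c j) * \<rho> ^ j)\<^sup>2)
    = (\<Sum>j=1..n. (norm (c j) * \<rho> ^ j)\<^sup>2) + b * (q * \<rho>)"
    by (simp add: b_def q_def power_mult_distrib power_mult[symmetric] power_add mult_ac)
  have s3: "1 - (\<Sum>j<Suc (Suc n). (norm (c j))\<^sup>2) = D - b"
    by (simp add: D_def b_def)
  have s4: "\<rho> ^ (2 * Suc n + 1) = q * \<rho> * \<rho>"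
    by (simp add: q_def)
  have "norm (c (2 * n + 1)) * q + norm (c (2 * n + 2)) * (q * \<rho>) \<le> D * q + (D - \<kappa> * b) * (q * \<rho>)"
    using 1 2 q0 \<rho> by (intro add_mono mult_right_mono) auto
  \<comment> \<open>The \<open>\<kappa>\<close> terms cancel; the rest of the new square is what the
    tail gains when \<open>D\<close> drops to \<open>D - b\<close>.\<close>
  moreover have "D * q + (D - \<kappa> * b) * (q * \<rho>) + (\<kappa> + \<rho> / (1 - \<rho>)) * (b * (q * \<rho>))
      = D * q / (1 - \<rho>) - (D - b) * (q * \<rho> * \<rho>) / (1 - \<rho>)"
  proof -
    \<comment> \<open>With the reciprocal as an atom, this is a polynomial identity modulo
      \<open>i * (1 - \<rho>) = 1\<close>.\<close>
    define i where "i = 1 / (1 - \<rho>)"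
    have "i * (1 - \<rho>) = 1" using \<rho>0 by (simp add: i_def)
    moreover have "D * q * i - (D - b) * (q * \<rho> * \<rho>) * i
        = D * q * (1 + \<rho>) * (i * (1 - \<rho>)) + \<rho> * i * (b * (q * \<rho>))"
      by (simp add: algebra_simps)
    ultimately have "D * q * i - (D - b) * (q * \<rho> * \<rho>) * i
        = D * q * (1 + \<rho>) + \<rho> * i * (b * (q * \<rho>))"
      by simp
    then show ?thesis by (simp add: i_def algebra_simps add_divide_distrib diff_divide_distrib)
  qed
  ultimately show ?case
    using Suc unfolding s1 s2 s3 s4 D_def[symmetric] q_def[symmetric] \<kappa>_def[symmetric]
    by (simp only: distrib_left)
qed

lemma refined_bohr:
  fixes c :: "nat \<Rightarrow> complex"
  assumes c: "bounded_power_series c" and \<rho>: "0 \<le> \<rho>" "\<rho> < 1"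
  defines "a \<equiv> norm (c 0)"
  shows "summable (\<lambda>j. norm (c (Suc j)) * \<rho> ^ Suc j)"
    and "summable (\<lambda>j. (norm (c (Suc j)) * \<rho> ^ Suc j)\<^sup>2)"
    and "(\<Sum>j. norm (c (Suc j)) * \<rho> ^ Suc j)
      + (1 / (1 + a) + \<rho> / (1 - \<rho>)) * (\<Sum>j. (norm (c (Suc j)) * \<rho> ^ Suc j)\<^sup>2)
    \<le> (1 - a\<^sup>2) * (\<rho> / (1 - \<rho>))"
proof -
  let ?b = "\<lambda>j. norm (c j) * \<rho> ^ j"
  \<comment> \<open>Carlson's odd bound has a nonnegative left side, so the squared coefficients sum
    to at most 1. This lets the subtracted tail be dropped and bounds each coefficient.\<close>
  have D: "0 \<le> 1 - (\<Sum>j<Suc n. (norm (c j))\<^sup>2)" for n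
    using carlson_odd[OF c, of n] norm_ge_zero[of "c (2 * n + 1)"] by linarith
  have c1: "norm (c j) \<le> 1" for j
  proof -
    have "(norm (c j))\<^sup>2 \<le> (\<Sum>j<Suc j. (norm (c j))\<^sup>2)"
      by (rule member_le_sum) auto
    then have "(norm (c j))\<^sup>2 \<le> 1\<^sup>2" using D[of j] by simp
    then show ?thesis by (rule power2_le_imp_le) simp
  qed
  have sm: "summable ?b"
  proof (rule summable_comparison_test)
    show "\<exists>N. \<forall>n\<ge>N. norm (?b n) \<le> \<rho> ^ n"
      using c1 \<rho> by (auto simp: norm_mult norm_power intro!: mult_left_le_one_le)
    show "summable ((^) \<rho>)" using \<rho> by (simp add: summable_geometric)
  qed
  then show s1: "summable (\<lambda>j. ?b (Suc j))" by (subst summable_Suc_iff)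
  have sm2: "summable (\<lambda>j. (?b j)\<^sup>2)"
  proof (rule summable_comparison_test[OF _ sm])
    have "(?b n)\<^sup>2 \<le> ?b n" for n
      unfolding power2_eq_square using c1 \<rho>
      by (intro mult_left_le_one_le) (auto intro!: mult_le_one power_le_one)
    then show "\<exists>N. \<forall>n\<ge>N. norm ((?b n)\<^sup>2) \<le> ?b n" by simp
  qed
  then show s2: "summable (\<lambda>j. (?b (Suc j))\<^sup>2)" by (subst summable_Suc_iff)
  let ?K = "1 / (1 + a) + \<rho> / (1 - \<rho>)"
  have shift: "(\<Sum>j=1..n. g j) = (\<Sum>j<n. g (Suc j))" for n and g :: "nat \<Rightarrow> real"
    by (simp add: sum.atLeast1_atMost_eq lessThan_Suc_atMost)
  have le: "(\<Sum>j<2 * n. ?b (Suc j)) + ?K * (\<Sum>j<n. (?b (Suc j))\<^sup>2) \<le> (1 - a\<^sup>2) * (\<rho> / (1 - \<rho>))" for n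
  proof -
    have "0 \<le> (1 - (\<Sum>j<Suc n. (norm (c j))\<^sup>2)) * \<rho> ^ (2 * n + 1) / (1 - \<rho>)"
      using D[of n] \<rho> by (intro divide_nonneg_nonneg mult_nonneg_nonneg) auto
    then show ?thesis
      using refined_bohr_partial[OF c \<rho>, of n] unfolding shift a_def by simp
  qed
  show "(\<Sum>j. ?b (Suc j)) + ?K * (\<Sum>j. (?b (Suc j))\<^sup>2) \<le> (1 - a\<^sup>2) * (\<rho> / (1 - \<rho>))"
  proof (rule LIMSEQ_le_const2)
    have "(\<lambda>n. \<Sum>j<2 * n. ?b (Suc j)) \<longlonglongrightarrow> (\<Sum>j. ?b (Suc j))"
      using LIMSEQ_subseq_LIMSEQ[OF summable_LIMSEQ[OF s1], of "\<lambda>n. 2 * n"]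
      by (simp add: strict_mono_def o_def)
    then show "(\<lambda>n. (\<Sum>j<2 * n. ?b (Suc j)) + ?K * (\<Sum>j<n. (?b (Suc j))\<^sup>2))
        \<longlonglongrightarrow> (\<Sum>j. ?b (Suc j)) + ?K * (\<Sum>j. (?b (Suc j))\<^sup>2)"
      by (intro tendsto_intros summable_LIMSEQ[OF s2])
  qed (use le in blast)
qed

section \<open>Norming functionals\<close>

text \<open>Hahn--Banach without partial functionals: by Zorn there is a pointwise minimal sublinear
  functional, and it is additive because it equals each of its shifts.\<close>
definition sublinear :: "('a::real_vector \<Rightarrow> real) \<Rightarrow> bool"
  where "sublinear q \<longleftrightarrow>
    (\<forall>x y. q (x + y) \<le> q x + q y) \<and> (\<forall>t x. 0 \<le> t \<longrightarrow> q (t *\<^sub>R x) = t * q x)"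

lemma sublinear_zero: "sublinear q \<Longrightarrow> q 0 = 0"
  unfolding sublinear_def by (metis mult_zero_left order_refl scaleR_zero_left)

lemma sublinear_minus: "sublinear q \<Longrightarrow> - q (- x) \<le> q x"
  using sublinear_zero[of q] unfolding sublinear_def
  by (metis add.right_inverse add.commute minus_le_iff diff_ge_0_iff_ge diff_minus_eq_add)

lemma sublinear_norm: "sublinear norm"
  by (simp add: sublinear_def norm_triangle_ineq)

text \<open>The choice \<open>t = 0\<close> keeps it below \<open>q\<close>, and
  \<open>t = 1\<close> pushes its value at \<open>- y\<close> down to \<open>- q y\<close>: it is
  \<open>q\<close> made linear along \<open>y\<close>. Every functional below it inherits the upper
  bound at \<open>- y\<close>.\<close>

definition sublinear_shift :: "('a::real_vector \<Rightarrow> real) \<Rightarrow> 'a \<Rightarrow> 'a \<Rightarrow> real"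
  where "sublinear_shift q y x = (INF t\<in>{0..}. q (x + t *\<^sub>R y) - t * q y)"

context
  fixes q :: "'a::real_vector \<Rightarrow> real" and y :: 'a
  assumes q: "sublinear q"
begin

text \<open>The bound is independent of \<open>t\<close>, so the real infimum is meaningful.\<close>

lemma sublinear_shift_lower:
  assumes "0 \<le> t"
  shows "- q (- x) \<le> q (x + t *\<^sub>R y) - t * q y"
proof -
  have "q (t *\<^sub>R y) \<le> q (x + t *\<^sub>R y) + q (- x)"
    using q unfolding sublinear_def by (metis add.commute add_diff_cancel_left' diff_conv_add_uminus)
  then show ?thesis using q assms by (simp add: sublinear_def)
qed

lemma sublinear_shift_le:
  assumes "0 \<le> t"
  shows "sublinear_shift q y x \<le> q (x + t *\<^sub>R y) - t * q y"
  unfolding sublinear_shift_def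
  by (rule cINF_lower) (use assms sublinear_shift_lower in \<open>auto intro!: bdd_belowI2\<close>)

lemma sublinear_shift_greatest:
  assumes "\<And>t. 0 \<le> t \<Longrightarrow> b \<le> q (x + t *\<^sub>R y) - t * q y"
  shows "b \<le> sublinear_shift q y x"
  unfolding sublinear_shift_def by (rule cINF_greatest) (use assms in auto)

lemma sublinear_sublinear_shift: "sublinear (sublinear_shift q y)"
proof -
  \<comment> \<open>One inequality suffices: with factor \<open>1 / t\<close> at
    \<open>t *\<^sub>R x\<close> it yields the converse.\<close>
  have scale: "sublinear_shift q y (s *\<^sub>R x) \<le> s * sublinear_shift q y x" if s: "s > 0" for s x
  proof -
    have "sublinear_shift q y (s *\<^sub>R x) / s \<le> sublinear_shift q y x"
    proof (rule sublinear_shift_greatest)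
      fix t :: real assume t: "0 \<le> t"
      have "sublinear_shift q y (s *\<^sub>R x) \<le> q (s *\<^sub>R x + (s * t) *\<^sub>R y) - s * t * q y"
        by (rule sublinear_shift_le) (use s t in auto)
      also have "s *\<^sub>R x + (s * t) *\<^sub>R y = s *\<^sub>R (x + t *\<^sub>R y)"
        by (simp add: scaleR_add_right)
      also have "q \<dots> = s * q (x + t *\<^sub>R y)"
        using q s by (simp add: sublinear_def)
      finally show "sublinear_shift q y (s *\<^sub>R x) / s \<le> q (x + t *\<^sub>R y) - t * q y"
        using s by (simp add: field_simps)
    qed
    then show ?thesis using s by (simp add: field_simps)
  qed
  have zero: "sublinear_shift q y 0 = 0"
  proof (rule antisym)
    show "sublinear_shift q y 0 \<le> 0"
      using sublinear_shift_le[of 0 0] sublinear_zero[OF q] by simp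
    show "0 \<le> sublinear_shift q y 0"
      by (rule sublinear_shift_greatest) (use q in \<open>simp add: sublinear_def\<close>)
  qed
  show ?thesis
    unfolding sublinear_def
  proof (intro conjI allI impI)
    fix x1 x2
    have *: "sublinear_shift q y (x1 + x2) - (q (x1 + t *\<^sub>R y) - t * q y) \<le> q (x2 + s *\<^sub>R y) - s * q y"
      if "0 \<le> t" "0 \<le> s" for t s
    proof -
      have "sublinear_shift q y (x1 + x2) \<le> q ((x1 + x2) + (t + s) *\<^sub>R y) - (t + s) * q y"
        by (rule sublinear_shift_le) (use that in auto)
      also have "(x1 + x2) + (t + s) *\<^sub>R y = (x1 + t *\<^sub>R y) + (x2 + s *\<^sub>R y)"
        by (simp add: scaleR_add_left)
      also have "q \<dots> \<le> q (x1 + t *\<^sub>R y) + q (x2 + s *\<^sub>R y)"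
        using q by (simp add: sublinear_def)
      finally show ?thesis by (simp add: algebra_simps)
    qed
    have "sublinear_shift q y (x1 + x2) - sublinear_shift q y x2 \<le> sublinear_shift q y x1"
    proof (rule sublinear_shift_greatest)
      fix t :: real assume t: "0 \<le> t"
      have "sublinear_shift q y (x1 + x2) - (q (x1 + t *\<^sub>R y) - t * q y) \<le> sublinear_shift q y x2"
        by (rule sublinear_shift_greatest) (rule *[OF t])
      then show "sublinear_shift q y (x1 + x2) - sublinear_shift q y x2 \<le> q (x1 + t *\<^sub>R y) - t * q y"
        by simp
    qed
    then show "sublinear_shift q y (x1 + x2) \<le> sublinear_shift q y x1 + sublinear_shift q y x2"
      by simp
  next
    fix t :: real and x assume t: "0 \<le> t"
    show "sublinear_shift q y (t *\<^sub>R x) = t * sublinear_shift q y x"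
    proof (cases "t = 0")
      case False
      then have t: "t > 0" using t by simp
      show ?thesis
      proof (rule antisym[OF scale[OF t]])
        have "sublinear_shift q y ((1 / t) *\<^sub>R (t *\<^sub>R x)) \<le> (1 / t) * sublinear_shift q y (t *\<^sub>R x)"
          by (rule scale) (use t in simp)
        then show "t * sublinear_shift q y x \<le> sublinear_shift q y (t *\<^sub>R x)"
          using t by (simp add: field_simps)
      qed
    qed (simp add: zero)
  qed
qed

end

lemma minimal_sublinear_exists:
  fixes q :: "'a::real_vector \<Rightarrow> real"
  assumes q: "sublinear q"
  obtains p where "sublinear p" "p \<le> q" "\<And>p'. sublinear p' \<Longrightarrow> p' \<le> p \<Longrightarrow> p' = p"
proof -
  define A where "A = {p. sublinear p \<and> p \<le> q}"
  \<comment> \<open>Zorn's lemma gives maximal elements, so the order is reversed and chains need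
    lower bounds.\<close>
  have po: "partial_order_on A (relation_of (\<ge>) A)"
    by (auto simp: partial_order_on_def preorder_on_def refl_on_def relation_of_def
        intro!: transI antisymI)
  have "\<exists>m\<in>A. \<forall>p\<in>A. m \<ge> p \<longrightarrow> p = m"
  proof (rule predicate_Zorn[OF po])
    fix C assume C: "C \<in> Chains (relation_of (\<ge>) A)"
    have CA: "p \<in> A" if "p \<in> C" for p
      using C that by (auto simp: Chains_def relation_of_def)
    have chain: "p \<le> p' \<or> p' \<le> p" if "p \<in> C" "p' \<in> C" for p p'
      using C that by (auto simp: Chains_def relation_of_def)
    show "\<exists>u\<in>A. \<forall>p\<in>C. p \<ge> u"
    proof (cases "C = {}")
      case True
      then show ?thesis using q by (auto simp: A_def)
    next
      case False
      define u where "u x = (INF p\<in>C. p x)" for x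
      have sub: "sublinear p" "p x \<le> q x" if "p \<in> C" for p x
        using CA[OF that] by (auto simp: A_def le_fun_def)
      have bdd: "bdd_below ((\<lambda>p. p x) ` C)" for x
      proof (rule bdd_belowI2)
        fix p assume "p \<in> C"
        then show "- q (- x) \<le> p x"
          using sublinear_minus[OF sub(1), of p x] sub(2)[of p "- x"] by linarith
      qed
      have le: "u x \<le> p x" if "p \<in> C" for p x
        unfolding u_def by (rule cINF_lower[OF bdd that])
      have great: "b \<le> u x" if "\<And>p. p \<in> C \<Longrightarrow> b \<le> p x" for b x
        unfolding u_def by (rule cINF_greatest[OF False that])
      have "sublinear u"
        unfolding sublinear_def
      proof (intro conjI allI impI)
        fix x y
        have *: "u (x + y) \<le> p x + p' y" if pp: "p \<in> C" "p' \<in> C" for p p'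
        proof -
          \<comment> \<open>A pointwise infimum of sublinear functionals need not be subadditive; in
            a chain the smaller of two members serves both arguments.\<close>
          obtain p'' where p'': "p'' \<in> C" "p'' \<le> p" "p'' \<le> p'"
            using chain[OF pp] pp by blast
          have "u (x + y) \<le> p'' x + p'' y"
            using le[OF p''(1), of "x + y"] sub(1)[OF p''(1)] unfolding sublinear_def by (meson order_trans)
          then show ?thesis using p''(2,3) by (smt (verit) le_fun_def)
        qed
        have "u (x + y) - u y \<le> u x"
        proof (rule great)
          fix p assume p: "p \<in> C"
          have "u (x + y) - p x \<le> u y"
            by (rule great) (use *[OF p] in \<open>simp add: algebra_simps\<close>)
          then show "u (x + y) - u y \<le> p x" by simp
        qed
        then show "u (x + y) \<le> u x + u y" by simp
      next
        fix t :: real and x assume t: "0 \<le> t"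
        have scale: "p (t *\<^sub>R x) = t * p x" if "p \<in> C" for p
          using sub(1)[OF that] t by (simp add: sublinear_def)
        show "u (t *\<^sub>R x) = t * u x"
        proof (cases "t = 0")
          case True
          obtain p where "p \<in> C" using False by blast
          have "u 0 = 0"
            using le[of p 0] great[of 0 0] sublinear_zero[OF sub(1)] \<open>p \<in> C\<close> by force
          then show ?thesis using True by simp
        next
          case False
          then have t: "t > 0" using t by simp
          show ?thesis
          proof (rule antisym)
            have "u (t *\<^sub>R x) / t \<le> u x"
              by (rule great) (use le[of _ "t *\<^sub>R x"] scale t in \<open>simp add: field_simps\<close>)
            then show "u (t *\<^sub>R x) \<le> t * u x" using t by (simp add: field_simps)
            show "t * u x \<le> u (t *\<^sub>R x)"
              by (rule great) (use t in \<open>simp add: scale le\<close>)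
          qed
        qed
      qed
      moreover have "u \<le> q"
        unfolding le_fun_def by (metis False all_not_in_conv le order_trans sub(2))
      ultimately show ?thesis
        using le by (intro bexI[of _ u]) (auto simp: A_def le_fun_def)
    qed
  qed
  then obtain m where m: "m \<in> A" "\<And>p. p \<in> A \<Longrightarrow> p \<le> m \<Longrightarrow> p = m" by blast
  show thesis
    by (rule that[of m]) (use m in \<open>auto simp: A_def\<close>)
qed

lemma minimal_sublinear_additive:
  assumes p: "sublinear p" and minimal: "\<And>p'. sublinear p' \<Longrightarrow> p' \<le> p \<Longrightarrow> p' = p"
  shows "p (x + y) = p x + p y"
proof (rule antisym)
  show "p (x + y) \<le> p x + p y" using p by (simp add: sublinear_def)
  have "sublinear_shift p y \<le> p"
    unfolding le_fun_def using sublinear_shift_le[OF p, of 0 y] by simp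
  then have "sublinear_shift p y = p"
    by (rule minimal[OF sublinear_sublinear_shift[OF p]])
  then show "p x + p y \<le> p (x + y)"
    using sublinear_shift_le[OF p, of 1 y x] by simp
qed

text \<open>Starting Zorn's lemma at the shift of the norm by \<open>x0\<close> replaces prescribing
  values on a line: everything below it is at most \<open>- norm x0\<close> at \<open>- x0\<close>,
  which linearity turns into \<open>norm x0 \<le> \<phi> x0\<close>.\<close>

theorem hahn_banach_real:
  fixes x0 :: "'a::real_normed_vector"
  obtains \<phi> :: "'a \<Rightarrow> real" where "linear \<phi>" "\<And>x. \<phi> x \<le> norm x" "\<phi> x0 = norm x0"
proof -
  obtain \<phi> where \<phi>: "sublinear \<phi>" "\<phi> \<le> sublinear_shift norm x0"
      "\<And>p'. sublinear p' \<Longrightarrow> p' \<le> \<phi> \<Longrightarrow> p' = \<phi>"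
    using minimal_sublinear_exists[OF sublinear_sublinear_shift[OF sublinear_norm]] by metis
  have le: "\<phi> x \<le> norm (x + t *\<^sub>R x0) - t * norm x0" if "0 \<le> t" for x t
    using \<phi>(2) sublinear_shift_le[OF sublinear_norm that, of x0 x] by (auto simp: le_fun_def intro: order_trans)
  have add: "\<phi> (x + y) = \<phi> x + \<phi> y" for x y
    by (rule minimal_sublinear_additive[OF \<phi>(1,3)])
  have neg: "\<phi> (- x) = - \<phi> x" for x
    using add[of x "- x"] sublinear_zero[OF \<phi>(1)] by simp
  have hom: "\<phi> (t *\<^sub>R x) = t * \<phi> x" if "0 \<le> t" for t x
    using \<phi>(1) that by (simp add: sublinear_def)
  have "\<phi> (t *\<^sub>R x) = t * \<phi> x" for t x
  proof (cases "t \<ge> 0")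
    case True
    then show ?thesis by (rule hom)
  next
    case False
    then show ?thesis using hom[of "- t" x] neg[of "t *\<^sub>R x"] by simp
  qed
  then have "linear \<phi>" by (intro linearI) (auto simp: add)
  moreover have n: "\<phi> x \<le> norm x" for x using le[of 0 x] by simp
  moreover have "\<phi> x0 = norm x0"
    using le[of 1 "- x0"] neg[of x0] n[of x0] by simp
  ultimately show thesis by (rule that)
qed

section \<open>Complex scalars and complex norming functionals\<close>

lemma scaleC_one [simp]: "1 *\<^sub>C (x :: 'a::complex_normed_vector) = x"
  using scaleR_scaleC[of 1 x] by simp

lemma scaleC_scaleR: "c *\<^sub>C t *\<^sub>R (x :: 'a::complex_normed_vector) = t *\<^sub>R c *\<^sub>C x"
  by (simp add: scaleR_scaleC scaleC_scaleC mult.commute)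

lemma bounded_bilinear_scaleC:
  "bounded_bilinear ((*\<^sub>C) :: complex \<Rightarrow> 'a \<Rightarrow> 'a::complex_normed_vector)"
proof
  show "(r *\<^sub>R c) *\<^sub>C x = r *\<^sub>R c *\<^sub>C x" for r c and x :: 'a
    unfolding scaleR_conv_of_real by (simp add: scaleR_scaleC scaleC_scaleC)
  show "\<exists>K. \<forall>c x. norm (c *\<^sub>C (x::'a)) \<le> norm c * norm x * K"
    by (rule exI[of _ 1]) (simp add: norm_scaleC)
qed (simp_all add: scaleC_add_left scaleC_add_right scaleC_scaleR)

lemma scaleC_zero_left [simp]: "0 *\<^sub>C (x :: 'a::complex_normed_vector) = 0"
  and scaleC_zero_right [simp]: "c *\<^sub>C (0 :: 'a::complex_normed_vector) = 0"
  by (simp_all add: bounded_bilinear.zero_left[OF bounded_bilinear_scaleC]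
      bounded_bilinear.zero_right[OF bounded_bilinear_scaleC])

theorem hahn_banach_complex:
  fixes x0 :: "'a::complex_normed_vector"
  obtains \<psi> :: "'a \<Rightarrow> complex" where "bounded_linear \<psi>" "\<And>c x. \<psi> (c *\<^sub>C x) = c * \<psi> x"
    "\<And>x. norm (\<psi> x) \<le> norm x" "\<psi> x0 = of_real (norm x0)"
proof -
  obtain \<phi> :: "'a \<Rightarrow> real" where \<phi>: "linear \<phi>" "\<And>x. \<phi> x \<le> norm x" "\<phi> x0 = norm x0"
    using hahn_banach_real[of x0] by blast
  \<comment> \<open>The only complex-linear functional with real part \<open>\<phi>\<close>.\<close>
  define \<psi> where "\<psi> x = Complex (\<phi> x) (- \<phi> (\<i> *\<^sub>C x))" for x
  have add: "\<psi> (x + y) = \<psi> x + \<psi> y" for x y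
    by (simp add: \<psi>_def scaleC_add_right linear_add[OF \<phi>(1)] complex_eq_iff)
  have hom: "\<psi> (c *\<^sub>C x) = c * \<psi> x" for c x
  proof -
    have c: "c *\<^sub>C y = Re c *\<^sub>R y + Im c *\<^sub>R \<i> *\<^sub>C y" for y :: 'a
      by (subst complex_eq[of c]) (simp add: scaleC_add_left scaleR_scaleC scaleC_scaleC mult.commute)
    have ii: "\<i> *\<^sub>C \<i> *\<^sub>C x = - x"
      using scaleR_scaleC[of "-1" x] by (simp add: scaleC_scaleC)
    show ?thesis
      unfolding c[of x] \<psi>_def
      by (simp add: linear_add[OF \<phi>(1)] linear_scale[OF \<phi>(1)] linear_neg[OF \<phi>(1)] linear_diff[OF \<phi>(1)]
          scaleC_add_right scaleC_scaleR ii complex_eq_iff)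
  qed
  have bound: "norm (\<psi> x) \<le> norm x" for x
  proof (cases "\<psi> x = 0")
    case False
    \<comment> \<open>A rotation that makes the value positive, so the bound on the real part
      controls the modulus.\<close>
    define c where "c = cnj (\<psi> x) / of_real (norm (\<psi> x))"
    have "c * \<psi> x = of_real (norm (\<psi> x))"
      using False unfolding c_def
      by (simp add: mult.commute[of "cnj _"] power2_eq_square flip: complex_norm_square)
    then have "norm (\<psi> x) = Re (\<psi> (c *\<^sub>C x))" by (simp add: hom)
    also have "\<dots> \<le> norm (c *\<^sub>C x)" using \<phi>(2) by (simp add: \<psi>_def)
    also have "\<dots> = norm x" using False by (simp add: norm_scaleC c_def norm_divide)
    finally show ?thesis .
  qed simp
  have "bounded_linear \<psi>"
  proof (rule bounded_linear_intro[where K=1])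
    show "\<psi> (r *\<^sub>R x) = r *\<^sub>R \<psi> x" for r x
      by (simp add: scaleR_scaleC[of r x] hom scaleR_conv_of_real)
  qed (use add bound in auto)
  moreover have "\<psi> x0 = of_real (norm x0)"
  proof -
    \<comment> \<open>The real part alone exhausts the bound \<open>norm x0\<close>, leaving no room
      for an imaginary part.\<close>
    have re: "Re (\<psi> x0) = norm x0" using \<phi>(3) by (simp add: \<psi>_def)
    have "(Re (\<psi> x0))\<^sup>2 + (Im (\<psi> x0))\<^sup>2 \<le> (norm x0)\<^sup>2"
      using bound[of x0] by (simp add: cmod_power2[symmetric] power_mono)
    then have "Im (\<psi> x0) = 0" using re by simp
    then show ?thesis using re by (simp add: complex_eq_iff)
  qed
  ultimately show thesis using that hom bound by blast
qed

section \<open>Homogeneous expansions along complex lines\<close>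

lemma homogeneous_polynomial_scaleC:
  assumes "homogeneous_polynomial j P"
  shows "P (c *\<^sub>C x) = c ^ j *\<^sub>C P x"
proof -
  obtain u where u: "multilinear_map j u" and P: "\<And>x. P x = u (\<lambda>_. x)"
    using assms by (auto simp: homogeneous_polynomial_def)
  \<comment> \<open>The scalar is pulled out of one argument at a time; \<open>k\<close> counts the
    scaled arguments.\<close>
  have "u (\<lambda>i. if i < k then c *\<^sub>C x else x) = c ^ k *\<^sub>C P x" if "k \<le> j" for k
    using that
  proof (induction k)
    case 0
    then show ?case by (simp add: P)
  next
    case (Suc k)
    let ?y = "\<lambda>i. if i < k then c *\<^sub>C x else x"
    have "(\<lambda>i. if i < Suc k then c *\<^sub>C x else x) = ?y(k := c *\<^sub>C x)" "?y = ?y(k := x)"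
      by (auto simp: fun_eq_iff)
    then have "u (\<lambda>i. if i < Suc k then c *\<^sub>C x else x) = c *\<^sub>C u ?y"
      using u Suc.prems unfolding multilinear_map_def by (metis Suc_le_eq)
    then show ?case using Suc by (simp add: scaleC_scaleC)
  qed
  moreover have "u (\<lambda>i. if i < j then c *\<^sub>C x else x) = u (\<lambda>_. c *\<^sub>C x)"
    using u unfolding multilinear_map_def by auto
  ultimately show ?thesis by (simp add: P)
qed

lemma homogeneous_polynomial_0_const: "homogeneous_polynomial 0 P \<Longrightarrow> P x = P y"
  by (auto simp: homogeneous_polynomial_def multilinear_map_def)

lemma homogeneous_polynomial_at_0:
  assumes "homogeneous_polynomial j P" "j > 0"
  shows "P 0 = 0"
  using homogeneous_polynomial_scaleC[OF assms(1), of 0 0] assms(2) by (simp add: power_0_left)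

lemma homogeneous_expansion_line:
  assumes "homogeneous_expansion f P" "norm x \<le> 1" "norm \<zeta> < 1"
  shows "(\<lambda>j. \<zeta> ^ j *\<^sub>C P j x) sums f (\<zeta> *\<^sub>C x)"
proof -
  have "norm (\<zeta> *\<^sub>C x) < 1"
    using assms(2,3) mult_left_le[of "norm x" "norm \<zeta>"] by (simp add: norm_scaleC)
  then show ?thesis
    using assms(1) unfolding homogeneous_expansion_def
    by (auto simp: homogeneous_polynomial_scaleC[symmetric])
qed

lemma homogeneous_expansion_0:
  assumes "homogeneous_expansion f P"
  shows "P 0 x = f 0"
proof -
  have h: "homogeneous_polynomial j (P j)" for j
    using assms by (simp add: homogeneous_expansion_def)
  have "(\<lambda>j. P j 0) sums f 0"
    using assms by (simp add: homogeneous_expansion_def)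
  moreover have "(\<lambda>j. P j 0) sums P 0 0"
    using sums_finite[of "{0}" "\<lambda>j. P j 0"] homogeneous_polynomial_at_0[OF h] by auto
  ultimately have "f 0 = P 0 0" by (rule sums_unique2)
  then show ?thesis using homogeneous_polynomial_0_const[OF h] by metis
qed

lemma bounded_power_series_line:
  fixes f :: "'a::complex_normed_vector \<Rightarrow> complex"
  assumes P: "homogeneous_expansion f P" and f: "f ` ball 0 1 \<subseteq> ball 0 1" and x: "norm x \<le> 1"
  shows "bounded_power_series (\<lambda>j. P j x)"
  unfolding bounded_power_series_def
proof (intro allI impI)
  fix \<zeta> :: complex assume \<zeta>: "norm \<zeta> < 1"
  have "(\<lambda>j. P j x * \<zeta> ^ j) sums f (\<zeta> *\<^sub>C x)"
    using homogeneous_expansion_line[OF P x \<zeta>] by (simp add: scaleC_complex_def mult.commute)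
  moreover have "\<zeta> *\<^sub>C x \<in> ball 0 1"
    using x \<zeta> mult_left_le[of "norm x" "norm \<zeta>"] by (simp add: norm_scaleC)
  then have "norm (f (\<zeta> *\<^sub>C x)) \<le> 1" using f by fastforce
  ultimately show "summable (\<lambda>j. P j x * \<zeta> ^ j) \<and> norm (\<Sum>j. P j x * \<zeta> ^ j) \<le> 1"
    by (auto simp: sums_iff)
qed

text \<open>The weight in \<open>bohr_G\<close> contains \<open>r ^ k\<close>, not the norm of
  \<open>\<mu> k z\<close>, so \<open>\<rho>\<close> is any upper bound below 1. Writing
  \<open>w\<close> as \<open>\<rho>\<close> times a point of the closed ball allows the scalar
  inequality at \<open>\<rho>\<close> itself.\<close>

lemma bohr_ball:
  fixes f :: "'a::complex_normed_vector \<Rightarrow> complex"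
  assumes P: "homogeneous_expansion f P" and f: "f ` ball 0 1 \<subseteq> ball 0 1"
    and w: "norm w \<le> \<rho>" and \<rho>: "\<rho> < 1"
  defines "a \<equiv> norm (f 0)"
  shows "summable (\<lambda>j. norm (P (Suc j) w))"
    and "summable (\<lambda>j. (norm (P (Suc j) w))\<^sup>2)"
    and "(\<Sum>j. norm (P (Suc j) w)) + (1 / (1 + a) + \<rho> / (1 - \<rho>)) * (\<Sum>j. (norm (P (Suc j) w))\<^sup>2)
      \<le> (1 - a\<^sup>2) * (\<rho> / (1 - \<rho>))"
    and "norm (f w - f 0) \<le> (1 - a\<^sup>2) * (\<rho> / (1 - \<rho>))"
proof -
  have \<rho>0: "0 \<le> \<rho>" using w norm_ge_zero order_trans by blast
  have h: "homogeneous_polynomial j (P j)" for j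
    using P by (simp add: homogeneous_expansion_def)
  obtain x where x: "norm x \<le> 1" "w = of_real \<rho> *\<^sub>C x"
  proof (cases "\<rho> = 0")
    case True
    then show thesis using that[of 0] w scaleR_scaleC[of \<rho> "0::'a"] by simp
  next
    case False
    then show thesis
      using that[of "(1 / \<rho>) *\<^sub>R w"] w \<rho>0 by (simp add: scaleR_scaleC[symmetric] field_simps)
  qed
  have n: "norm (P j w) = norm (P j x) * \<rho> ^ j" for j
    using homogeneous_polynomial_scaleC[OF h, of j "of_real \<rho>" x] \<rho>0
    by (simp add: x(2) norm_scaleC norm_power mult.commute)
  note b = refined_bohr[OF bounded_power_series_line[OF P f x(1)] \<rho>0 \<rho>]
  have a: "norm (P 0 x) = a" unfolding a_def homogeneous_expansion_0[OF P] ..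
  show s1: "summable (\<lambda>j. norm (P (Suc j) w))" and s2: "summable (\<lambda>j. (norm (P (Suc j) w))\<^sup>2)"
    using b(1,2) unfolding n .
  show le: "(\<Sum>j. norm (P (Suc j) w)) + (1 / (1 + a) + \<rho> / (1 - \<rho>)) * (\<Sum>j. (norm (P (Suc j) w))\<^sup>2)
      \<le> (1 - a\<^sup>2) * (\<rho> / (1 - \<rho>))"
    using b(3) unfolding n a .
  have "(\<lambda>j. P j w) sums f w"
    using P w \<rho> by (auto simp: homogeneous_expansion_def)
  then have "(\<lambda>j. P (Suc j) w) sums (f w - f 0)"
    by (subst sums_Suc_iff) (simp add: homogeneous_expansion_0[OF P])
  then have "norm (f w - f 0) \<le> (\<Sum>j. norm (P (Suc j) w))"
    using summable_norm[OF s1] by (simp add: sums_iff)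
  moreover have "0 \<le> (1 / (1 + a) + \<rho> / (1 - \<rho>)) * (\<Sum>j. (norm (P (Suc j) w))\<^sup>2)"
    using \<rho>0 \<rho> by (intro mult_nonneg_nonneg suminf_nonneg s2 add_nonneg_nonneg divide_nonneg_nonneg)
      (auto simp: a_def)
  ultimately show "norm (f w - f 0) \<le> (1 - a\<^sup>2) * (\<rho> / (1 - \<rho>))" using le by linarith
qed

section \<open>The Schwarz lemma at a zero of higher order\<close>

text \<open>Shifting the coefficients divides by \<open>z ^ n\<close> and stays holomorphic at 0. On
  the circle of radius \<open>s\<close> the quotient is at most \<open>inverse (s ^ n)\<close>; the
  maximum principle carries this inside, and \<open>s\<close> tends to 1.\<close>

lemma schwarz_power_series:
  assumes c: "bounded_power_series c" and zero: "\<And>j. j < n \<Longrightarrow> c j = 0" and z: "norm z < 1"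
  shows "norm (\<Sum>j. c j * z ^ j) \<le> norm z ^ n"
proof -
  define h where "h z = (\<Sum>j. c (j + n) * z ^ j)" for z
  have sm: "summable (\<lambda>j. c (j + n) * w ^ j)" if w: "norm w < 1" for w
  proof (cases "w = 0")
    case False
    have "summable (\<lambda>j. c (j + n) * w ^ (j + n))"
      using c w by (subst summable_iff_shift) (auto simp: bounded_power_series_def)
    then have "summable (\<lambda>j. w ^ n * (c (j + n) * w ^ j))"
      by (simp add: power_add mult_ac)
    then show ?thesis using False by (subst (asm) summable_cmult_iff) auto
  qed simp
  have fact: "(\<Sum>j. c j * w ^ j) = w ^ n * h w" if w: "norm w < 1" for w
  proof -
    have "(\<Sum>j. c j * w ^ j) = (\<Sum>j. c (j + n) * w ^ (j + n)) + (\<Sum>j<n. c j * w ^ j)"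
      by (rule suminf_split_initial_segment) (use c w in \<open>auto simp: bounded_power_series_def\<close>)
    also have "\<dots> = (\<Sum>j. w ^ n * (c (j + n) * w ^ j))"
      by (simp add: zero power_add mult_ac)
    finally show ?thesis unfolding h_def using suminf_mult[OF sm[OF w]] by simp
  qed
  have hol: "h holomorphic_on ball 0 1"
    by (rule power_series_holomorphic[where a="\<lambda>j. c (j + n)"])
       (use sm in \<open>auto simp: h_def dist_norm intro!: summable_sums\<close>)
  have le: "norm (h z) \<le> inverse (s ^ n)" if s: "norm z < s" "s < 1" for s
  proof (rule maximum_modulus_frontier[where f=h and S="cball 0 s"])
    show "h holomorphic_on interior (cball 0 s)"
      using hol by (rule holomorphic_on_subset) (use s in auto)
    show "continuous_on (closure (cball 0 s)) h"
      using holomorphic_on_imp_continuous_on[OF hol]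
      by (rule continuous_on_subset) (use s in auto)
    have s0: "s > 0" using s norm_ge_zero[of z] by linarith
    fix w assume "w \<in> frontier (cball (0::complex) s)"
    then have w: "norm w = s" using s0 by (simp add: sphere_def)
    have "norm (w ^ n * h w) \<le> 1"
      using c s w fact[of w] by (auto simp: bounded_power_series_def)
    then show "norm (h w) \<le> inverse (s ^ n)"
      using s0 by (simp add: norm_mult norm_power w field_simps)
  qed (use s in auto)
  have "norm (h z) \<le> 1"
  proof (rule tendsto_lowerbound)
    show "((\<lambda>s. inverse (s ^ n)) \<longlongrightarrow> (1::real)) (at_left 1)"
      by (auto intro!: tendsto_eq_intros)
    have "\<forall>\<^sub>F s in at_left (1::real). s \<in> {norm z<..<1}"
      by (rule eventually_at_left_real) (use z in simp)
    then show "\<forall>\<^sub>F s in at_left 1. norm (h z) \<le> inverse (s ^ n)"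
      by eventually_elim (use le in auto)
  qed auto
  then show ?thesis
    by (simp add: fact[OF z] norm_mult norm_power mult_left_le)
qed

text \<open>Composing with a functional that norms \<open>\<mu> z\<close> and restricting to the
  line through \<open>z\<close> gives a scalar series, without loss of norm at
  \<open>z\<close>.\<close>

lemma schwarz_mapping_zero_of_order:
  fixes \<mu> :: "'a::complex_normed_vector \<Rightarrow> 'a"
  assumes \<mu>: "schwarz_mapping \<mu>" "zero_of_order \<mu> n" and z: "norm z < 1"
  shows "norm (\<mu> z) \<le> norm z ^ n"
proof (cases "z = 0")
  case True
  then show ?thesis using \<mu>(1) by (simp add: schwarz_mapping_def)
next
  case False
  obtain Q where Q: "homogeneous_expansion \<mu> Q" and Q0: "\<And>j x. j < n \<Longrightarrow> Q j x = 0"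
    using \<mu>(2) by (auto simp: zero_of_order_def)
  obtain \<psi> :: "'a \<Rightarrow> complex" where \<psi>: "bounded_linear \<psi>" "\<And>c x. \<psi> (c *\<^sub>C x) = c * \<psi> x"
      "\<And>x. norm (\<psi> x) \<le> norm x" "\<psi> (\<mu> z) = of_real (norm (\<mu> z))"
    using hahn_banach_complex[of "\<mu> z"] by blast
  define x where "x = (1 / norm z) *\<^sub>R z"
  have x: "norm x \<le> 1" "of_real (norm z) *\<^sub>C x = z"
    using False by (auto simp: x_def scaleR_scaleC[symmetric])
  have sums: "(\<lambda>j. \<psi> (Q j x) * \<zeta> ^ j) sums \<psi> (\<mu> (\<zeta> *\<^sub>C x))" if "norm \<zeta> < 1" for \<zeta>
    using bounded_linear.sums[OF \<psi>(1) homogeneous_expansion_line[OF Q x(1) that]]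
    by (simp add: \<psi>(2) mult.commute)
  have "bounded_power_series (\<lambda>j. \<psi> (Q j x))"
    unfolding bounded_power_series_def
  proof (intro allI impI)
    fix \<zeta> :: complex assume \<zeta>: "norm \<zeta> < 1"
    have "\<zeta> *\<^sub>C x \<in> ball 0 1"
      using x \<zeta> mult_left_le[of "norm x" "norm \<zeta>"] by (simp add: norm_scaleC)
    then have "norm (\<mu> (\<zeta> *\<^sub>C x)) < 1" using \<mu>(1) by (fastforce simp: schwarz_mapping_def)
    then have "norm (\<psi> (\<mu> (\<zeta> *\<^sub>C x))) \<le> 1" using \<psi>(3)[of "\<mu> (\<zeta> *\<^sub>C x)"] by linarith
    then show "summable (\<lambda>j. \<psi> (Q j x) * \<zeta> ^ j) \<and> norm (\<Sum>j. \<psi> (Q j x) * \<zeta> ^ j) \<le> 1"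
      using sums[OF \<zeta>] by (auto simp: sums_iff)
  qed
  then have "norm (\<Sum>j. \<psi> (Q j x) * of_real (norm z) ^ j) \<le> norm (complex_of_real (norm z)) ^ n"
    by (rule schwarz_power_series) (use z Q0 linear_0[OF bounded_linear.linear[OF \<psi>(1)]] in auto)
  then show ?thesis
    using sums[of "of_real (norm z)"] z by (simp add: sums_iff x \<psi>(4))
qed

section \<open>The Bohr radius\<close>

lemma div_one_minus_power_strict_mono:
  fixes r s :: real
  assumes "0 \<le> r" "r < s" "s < 1" "n \<ge> 1"
  shows "r ^ n / (1 - r ^ n) < s ^ n / (1 - s ^ n)"
proof -
  have "r ^ n < s ^ n" "s ^ n < 1"
    using assms by (auto intro!: power_strict_mono power_less_one_iff[THEN iffD2])
  then show ?thesis by (simp add: field_simps)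
qed

lemma ex1_bohr_root:
  assumes k: "k \<ge> 1" and m: "m \<ge> 1" and p: "0 < p" "p \<le> 2"
  shows "\<exists>!r. is_bohr_root p k m r"
proof -
  define g where "g r = r ^ k / (1 - r ^ k) + r ^ m / (1 - r ^ m)" for r :: real
  have mono: "g r < g s" if "0 \<le> r" "r < s" "s < 1" for r s
    unfolding g_def using that k m by (intro add_strict_mono div_one_minus_power_strict_mono)
  \<comment> \<open>At \<open>t\<close> the first summand is 1, which is at least
    \<open>p / 2\<close>, and \<open>{0..t}\<close> avoids the pole at 1.\<close>
  define t where "t = root k (1 / 2)"
  have t: "0 < t" "t < 1" "t ^ k = 1 / 2"
    using k by (auto simp: t_def real_root_lt_1_iff)
  have t1: "r ^ n < 1" if "0 \<le> r" "r \<le> t" "n \<ge> 1" for r n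
    using that t by (auto intro!: power_less_one_iff[THEN iffD2])
  have "\<exists>r. 0 \<le> r \<and> r \<le> t \<and> g r = p / 2"
  proof (rule IVT')
    show "g 0 \<le> p / 2" using k m p by (simp add: g_def power_0_left)
    have "g t \<ge> t ^ k / (1 - t ^ k)"
      using t1[of t m] t m by (auto simp: g_def intro!: divide_nonneg_nonneg)
    then show "p / 2 \<le> g t" using p by (simp add: t(3))
    show "continuous_on {0..t} g"
      unfolding g_def using t1[OF _ _ k] t1[OF _ _ m]
      by (intro continuous_intros) (fastforce+)
  qed (use t in auto)
  then obtain r where r: "0 \<le> r" "r \<le> t" "g r = p / 2" by blast
  have root: "is_bohr_root p k m s \<longleftrightarrow> 0 < s \<and> s < 1 \<and> g s = p / 2" for s
    by (auto simp: is_bohr_root_def g_def)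
  have "r \<noteq> 0" using r(3) k m p by (auto simp: g_def power_0_left)
  then have "is_bohr_root p k m r" using r t by (simp add: root)
  moreover have "s = s'" if "is_bohr_root p k m s" "is_bohr_root p k m s'" for s s'
    using that mono[of s s'] mono[of s' s] by (cases s s' rule: linorder_cases) (auto simp: root)
  ultimately show ?thesis by blast
qed

section \<open>The upper bound for \<open>bohr_G\<close>\<close>

lemma powr_le_chord:
  fixes a p :: real
  assumes a: "0 \<le> a" and p: "0 < p" "p \<le> 2"
  shows "a powr p + (1 - a\<^sup>2) * (p / 2) \<le> 1"
proof (cases "a = 0")
  case False
  \<comment> \<open>Weighted AM-GM for \<open>a\<^sup>2\<close> and 1: the concave power with
    exponent \<open>p / 2\<close> lies below its tangent at 1.\<close>
  then have "(a\<^sup>2) powr (p / 2) * 1 powr (1 - p / 2) \<le> p / 2 * a\<^sup>2 + (1 - p / 2) * 1"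
    using p by (intro Youngs_inequality_0) auto
  moreover have "(a\<^sup>2) powr (p / 2) = a powr p"
    using a False powr_powr[of a 2 "p / 2"] by simp
  ultimately show ?thesis by (simp add: algebra_simps)
qed (use p in simp)

lemma bohr_inequality:
  fixes f :: "'a::complex_normed_vector \<Rightarrow> complex"
  assumes k: "k \<ge> 1" and m: "m \<ge> 1" and p: "0 < p" "p \<le> 2"
    and data: "bohr_data f P \<mu>" and z: "norm z \<le> R" and R: "is_bohr_root p k m R"
  shows "bohr_G_converges k P \<mu> z \<and> bohr_G p k m f P \<mu> z \<le> 1"
proof -
  define r where "r = norm z"
  define a where "a = norm (f 0)"
  have r: "0 \<le> r" "r < 1" "r \<le> R" "norm z < 1"
    using z R by (auto simp: r_def is_bohr_root_def)
  have P: "homogeneous_expansion f P" and f: "f ` ball 0 1 \<subseteq> ball 0 1"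
    and \<mu>: "\<And>n. n \<ge> 1 \<Longrightarrow> schwarz_mapping (\<mu> n)" "\<And>n. n \<ge> 1 \<Longrightarrow> zero_of_order (\<mu> n) n"
    using data by (auto simp: bohr_data_def)
  have a: "0 \<le> a" "a < 1" using f by (auto simp: a_def image_subset_iff)
  have rn: "r ^ n < 1" if "n \<ge> 1" for n
    using r that by (auto intro!: power_less_one_iff[THEN iffD2])
  have \<mu>n: "norm (\<mu> n z) \<le> r ^ n" if "n \<ge> 1" for n
    unfolding r_def by (rule schwarz_mapping_zero_of_order[OF \<mu>[OF that] r(4)])
  note bk = bohr_ball[OF P f \<mu>n[OF k] rn[OF k], folded a_def]
  note bm = bohr_ball[OF P f \<mu>n[OF m] rn[OF m], folded a_def]
  have mono: "r ^ n / (1 - r ^ n) \<le> R ^ n / (1 - R ^ n)" if "n \<ge> 1" for n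
    using div_one_minus_power_strict_mono[of r R n] r R that
    by (cases "r = R") (auto simp: is_bohr_root_def)
  have "bohr_G p k m f P \<mu> z
      \<le> a powr p + ((1 - a\<^sup>2) * (r ^ k / (1 - r ^ k)) + (1 - a\<^sup>2) * (r ^ m / (1 - r ^ m)))"
    using bk(3) bm(4) unfolding bohr_G_def Let_def a_def[symmetric] r_def[symmetric] by linarith
  also have "\<dots> = a powr p + (1 - a\<^sup>2) * (r ^ k / (1 - r ^ k) + r ^ m / (1 - r ^ m))"
    by (simp only: distrib_left)
  also have "\<dots> \<le> a powr p + (1 - a\<^sup>2) * (p / 2)"
  proof (intro add_left_mono mult_left_mono)
    show "r ^ k / (1 - r ^ k) + r ^ m / (1 - r ^ m) \<le> p / 2"
      using mono[OF k] mono[OF m] R unfolding is_bohr_root_def by linarith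
    show "0 \<le> 1 - a\<^sup>2" using a by (simp add: power_le_one)
  qed
  also have "\<dots> \<le> 1" by (rule powr_le_chord[OF a(1) p])
  finally show ?thesis using bk(1,2) by (simp add: bohr_G_converges_def)
qed

section \<open>Extremal mappings\<close>

lemma homogeneous_polynomial_zero: "homogeneous_polynomial j (\<lambda>_. 0)"
  unfolding homogeneous_polynomial_def multilinear_map_def
  by (rule exI[of _ "\<lambda>_. 0"]) simp

context
  fixes \<psi> :: "'a::complex_normed_vector \<Rightarrow> complex"
  assumes \<psi>: "bounded_linear \<psi>" "\<And>c x. \<psi> (c *\<^sub>C x) = c * \<psi> x"
begin

lemma prod_functional_update:
  fixes i j :: nat
  assumes "i < j"
  shows "(\<Prod>l<j. \<psi> ((x(i := v)) l)) = \<psi> v * (\<Prod>l\<in>{..<j} - {i}. \<psi> (x l))"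
proof -
  have "(\<Prod>l<j. \<psi> ((x(i := v)) l)) = \<psi> v * (\<Prod>l\<in>{..<j} - {i}. \<psi> ((x(i := v)) l))"
    using assms by (subst prod.remove[of "{..<j}" i]) auto
  also have "(\<Prod>l\<in>{..<j} - {i}. \<psi> ((x(i := v)) l)) = (\<Prod>l\<in>{..<j} - {i}. \<psi> (x l))"
    by (rule prod.cong) auto
  finally show ?thesis .
qed

lemma continuous_on_prod_functional:
  "continuous_on UNIV (\<lambda>x :: nat \<Rightarrow> 'a. \<Prod>l<j. \<psi> (x l))"
  by (intro continuous_on_prod bounded_linear.continuous_on[OF \<psi>(1)] continuous_on_product_coordinates)

lemma homogeneous_polynomial_power: "homogeneous_polynomial j (\<lambda>x. c * \<psi> x ^ j)"
proof -
  let ?u = "\<lambda>x. c * (\<Prod>l<j. \<psi> (x l))"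
  have "multilinear_map j ?u"
    unfolding multilinear_map_def
    by (auto simp: prod_functional_update scaleC_complex_def \<psi>(2) algebra_simps
        linear_add[OF bounded_linear.linear[OF \<psi>(1)]] simp del: fun_upd_apply)
  moreover have "continuous_on UNIV ?u"
    by (intro continuous_intros continuous_on_prod_functional)
  ultimately show ?thesis
    unfolding homogeneous_polynomial_def by (intro exI[of _ ?u]) simp
qed

lemma homogeneous_polynomial_power_scaleC:
  "homogeneous_polynomial (Suc j) (\<lambda>x. \<psi> x ^ j *\<^sub>C x)"
proof -
  \<comment> \<open>Slots below \<open>j\<close> feed the scalar factor and slot \<open>j\<close>
    carries the vector. The map is not symmetric in general; only its diagonal matters.\<close>
  let ?u = "\<lambda>x. (\<Prod>l<j. \<psi> (x l)) *\<^sub>C x j"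
  have upd: "?u (x(i := v))
      = (if i = j then (\<Prod>l<j. \<psi> (x l)) *\<^sub>C v else (\<psi> v * (\<Prod>l\<in>{..<j} - {i}. \<psi> (x l))) *\<^sub>C x j)"
    if "i < Suc j" for x i v
  proof (cases "i = j")
    case True
    have "(\<Prod>l<j. \<psi> ((x(i := v)) l)) = (\<Prod>l<j. \<psi> (x l))"
      using True by (intro prod.cong) auto
    then show ?thesis using True by simp
  next
    case False
    then show ?thesis using that by (subst prod_functional_update) auto
  qed
  have "multilinear_map (Suc j) ?u"
    unfolding multilinear_map_def
  proof (intro conjI allI impI)
    fix x y :: "nat \<Rightarrow> 'a" assume "\<forall>i<Suc j. x i = y i"
    then show "?u x = ?u y" by (auto intro!: arg_cong2[of _ _ _ _ "(*\<^sub>C)"] prod.cong)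
  next
    fix i x a b assume "i < Suc j"
    then show "?u (x(i := a + b)) = ?u (x(i := a)) + ?u (x(i := b))"
      by (simp only: upd) (simp add: scaleC_add_right scaleC_add_left distrib_right
          linear_add[OF bounded_linear.linear[OF \<psi>(1)]])
  next
    fix i x c a assume "i < Suc j"
    then show "?u (x(i := c *\<^sub>C a)) = c *\<^sub>C ?u (x(i := a))"
      by (simp only: upd) (simp add: scaleC_scaleC \<psi>(2) mult_ac)
  qed
  moreover have "continuous_on UNIV ?u"
    by (intro bounded_bilinear.continuous_on[OF bounded_bilinear_scaleC]
        continuous_on_prod_functional continuous_on_product_coordinates)
  ultimately show ?thesis
    unfolding homogeneous_polynomial_def by (intro exI[of _ ?u]) simp
qed

lemma holomorphic_map_on_compose_functional:
  assumes F: "F holomorphic_on ball 0 1" and \<psi>1: "\<And>x. norm (\<psi> x) \<le> norm x"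
  shows "holomorphic_map_on (\<lambda>x. F (\<psi> x)) (ball 0 1)"
  unfolding holomorphic_map_on_def
proof
  fix x :: 'a assume "x \<in> ball 0 1"
  then have "\<psi> x \<in> ball 0 1" using \<psi>1[of x] by simp
  then obtain d where "(F has_field_derivative d) (at (\<psi> x))"
    using F holomorphic_on_imp_differentiable_at[OF F open_ball] by (auto simp: field_differentiable_def)
  then have "(F has_derivative (*) d) (at (\<psi> x))"
    by (simp add: has_field_derivative_def)
  then have "((\<lambda>x. F (\<psi> x)) has_derivative (\<lambda>v. d * \<psi> v)) (at x)"
    by (rule has_derivative_compose[OF bounded_linear_imp_has_derivative[OF \<psi>(1)]])
  then show "\<exists>D. ((\<lambda>x. F (\<psi> x)) has_derivative D) (at x) \<and> (\<forall>c v. D (c *\<^sub>C v) = c *\<^sub>C D v)"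
    by (intro exI[of _ "\<lambda>v. d * \<psi> v"]) (simp add: \<psi>(2) scaleC_complex_def)
qed

lemma holomorphic_map_on_power_scaleC: "holomorphic_map_on (\<lambda>x. \<psi> x ^ j *\<^sub>C x) S"
  unfolding holomorphic_map_on_def
proof
  fix x
  let ?d = "\<lambda>v. of_nat j * (\<psi> v * \<psi> x ^ (j - 1))"
  have "((\<lambda>x. \<psi> x ^ j) has_derivative ?d) (at x)"
    by (rule has_derivative_power[OF bounded_linear_imp_has_derivative[OF \<psi>(1)], THEN has_derivative_eq_rhs])
       (simp add: mult_ac)
  then have "((\<lambda>x. \<psi> x ^ j *\<^sub>C x) has_derivative (\<lambda>v. \<psi> x ^ j *\<^sub>C v + ?d v *\<^sub>C x)) (at x)"
    using bounded_bilinear.FDERIV[OF bounded_bilinear_scaleC _ has_derivative_ident] by blast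
  then show "\<exists>D. ((\<lambda>x. \<psi> x ^ j *\<^sub>C x) has_derivative D) (at x) \<and> (\<forall>c v. D (c *\<^sub>C v) = c *\<^sub>C D v)"
    by (intro exI[of _ "\<lambda>v. \<psi> x ^ j *\<^sub>C v + ?d v *\<^sub>C x"] conjI) (simp_all add: \<psi>(2) scaleC_add_right scaleC_scaleC mult_ac)
qed

lemma power_scaleC_zero_of_order:
  assumes x: "\<psi> x \<noteq> 0" and n: "n \<ge> 1"
  shows "zero_of_order (\<lambda>x. \<psi> x ^ (n - 1) *\<^sub>C x) n"
proof -
  let ?\<mu> = "\<lambda>x. \<psi> x ^ (n - 1) *\<^sub>C x"
  let ?Q = "\<lambda>j. if j = n then ?\<mu> else (\<lambda>_. 0)"
  have "homogeneous_polynomial j (?Q j)" for j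
    using homogeneous_polynomial_power_scaleC[of "n - 1"] homogeneous_polynomial_zero n by auto
  moreover have "(\<lambda>j. ?Q j z) sums ?\<mu> z" for z
    using sums_single[of n "\<lambda>_. ?\<mu> z"] by (simp add: if_distribR cong: if_cong)
  ultimately have "homogeneous_expansion ?\<mu> ?Q"
    unfolding homogeneous_expansion_def by blast
  moreover have "\<psi> (?\<mu> x) \<noteq> 0" using x by (simp add: \<psi>(2))
  then have "?Q n x \<noteq> 0" using linear_0[OF bounded_linear.linear[OF \<psi>(1)]] by auto
  ultimately show ?thesis
    unfolding zero_of_order_def by (intro exI[of _ ?Q]) auto
qed

lemma power_scaleC_schwarz_mapping:
  assumes "\<And>x. norm (\<psi> x) \<le> norm x"
  shows "schwarz_mapping (\<lambda>x. \<psi> x ^ j *\<^sub>C x)"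
proof -
  have "norm (\<psi> x ^ j *\<^sub>C x) < 1" if "norm x < 1" for x
  proof -
    have "norm (\<psi> x) ^ j \<le> 1" using assms[of x] that by (intro power_le_one) auto
    then have "norm (\<psi> x ^ j *\<^sub>C x) \<le> norm x"
      by (simp add: norm_scaleC norm_power mult_left_le_one_le)
    then show ?thesis using that by simp
  qed
  moreover have "\<psi> 0 ^ j *\<^sub>C (0::'a) = 0"
    using norm_scaleC[of "\<psi> 0 ^ j" "0::'a"] by simp
  ultimately show ?thesis
    unfolding schwarz_mapping_def using holomorphic_map_on_power_scaleC by auto
qed

text \<open>The difference f - a equals -(1-a^2)\<psi>/(1-a\<psi>), a geometric series in
  a\<psi>.\<close>

lemma moebius_expansion:
  assumes \<psi>1: "\<And>x. norm (\<psi> x) \<le> norm x" and a: "0 \<le> a" "a < 1"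
  shows "homogeneous_expansion (\<lambda>x. (of_real a - \<psi> x) / (1 - of_real a * \<psi> x))
    (\<lambda>j x. if j = 0 then of_real a else - of_real ((1 - a\<^sup>2) * a ^ (j - 1)) * \<psi> x ^ j)"
    (is "homogeneous_expansion ?f ?P")
  unfolding homogeneous_expansion_def
proof (intro conjI allI ballI)
  fix j
  show "homogeneous_polynomial j (?P j)"
    using homogeneous_polynomial_power[of 0 "of_real a"]
      homogeneous_polynomial_power[of j "- of_real ((1 - a\<^sup>2) * a ^ (j - 1))"]
    by (cases "j = 0") auto
next
  fix x :: 'a assume "x \<in> ball 0 1"
  then have w: "norm (\<psi> x) < 1" using \<psi>1[of x] by simp
  have aw: "norm (of_real a * \<psi> x) < 1"
    using w a mult_left_le_one_le[of "norm (\<psi> x)" a] by (simp add: norm_mult)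
  then have ne: "1 - of_real a * \<psi> x \<noteq> 0" by auto
  have "(\<lambda>j. - of_real (1 - a\<^sup>2) * \<psi> x * (of_real a * \<psi> x) ^ j)
      sums (- of_real (1 - a\<^sup>2) * \<psi> x * (1 / (1 - of_real a * \<psi> x)))"
    by (intro sums_mult geometric_sums aw)
  moreover have "- of_real (1 - a\<^sup>2) * \<psi> x * (1 / (1 - of_real a * \<psi> x)) = ?f x - of_real a"
    using ne by (simp add: field_simps power2_eq_square)
  moreover have "- of_real (1 - a\<^sup>2) * \<psi> x * (of_real a * \<psi> x) ^ j = ?P (Suc j) x" for j
    by (simp add: power_mult_distrib algebra_simps)
  ultimately have "(\<lambda>j. ?P (Suc j) x) sums (?f x - of_real a)" by simp
  then have "(\<lambda>j. ?P j x) sums (?f x - of_real a + ?P 0 x)"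
    by (rule sums_Suc[where f="\<lambda>j. ?P j x"])
  then show "(\<lambda>j. ?P j x) sums ?f x" by simp
qed

end

section \<open>Sharpness of the radius\<close>

lemma bohr_sharp:
  fixes x0 :: "'a::complex_normed_vector"
  assumes x0: "x0 \<noteq> 0" and k: "k \<ge> 1" and m: "m \<ge> 1" and R: "0 < R" "R < 1"
    and large: "R ^ k / (1 - R ^ k) + R ^ m / (1 - R ^ m) > p / 2"
  shows "\<exists>(f :: 'a \<Rightarrow> complex) P \<mu> z. bohr_data f P \<mu> \<and> z \<in> ball 0 1 \<and> norm z \<le> R \<and>
    bohr_G_converges k P \<mu> z \<and> bohr_G p k m f P \<mu> z > 1"
proof -
  have Rn: "0 < R ^ n" "R ^ n < 1" if "n \<ge> 1" for n
    using R that by (auto intro!: power_less_one_iff[THEN iffD2])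
  define \<rho> where "\<rho> = R ^ k"
  define \<tau> where "\<tau> = R ^ m"
  have \<rho>: "0 < \<rho>" "\<rho> < 1" and \<tau>: "0 < \<tau>" "\<tau> < 1"
    unfolding \<rho>_def \<tau>_def using Rn k m by auto
  \<comment> \<open>\<open>bohr_G\<close> of the extremal maps without its square sum. At
    \<open>a = 1\<close> the factor \<open>1 - a\<^sup>2\<close> vanishes, so the bracket enters the
    derivative only through its value.\<close>
  define \<Phi> where "\<Phi> a = a powr p + (1 - a\<^sup>2) * (\<rho> / (1 - a * \<rho>) + \<tau> / (1 - a * \<tau>))" for a
  have "(\<Phi> has_real_derivative (p - 2 * (\<rho> / (1 - \<rho>) + \<tau> / (1 - \<tau>)))) (at 1)"
    unfolding \<Phi>_def using \<rho> \<tau>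
    by (auto intro!: derivative_eq_intros)
  moreover have "p - 2 * (\<rho> / (1 - \<rho>) + \<tau> / (1 - \<tau>)) < 0"
  proof -
    have "p - 2 * s < 0" if "p / 2 < s" for s using that by linarith
    then show ?thesis using large unfolding \<rho>_def \<tau>_def by blast
  qed
  ultimately obtain d where d: "d > 0" "\<And>h. 0 < h \<Longrightarrow> h < d \<Longrightarrow> \<Phi> 1 < \<Phi> (1 - h)"
    using DERIV_neg_dec_left by blast
  define a where "a = 1 - min (d / 2) (1 / 2)"
  have a: "0 < a" "a < 1" using d by (auto simp: a_def min_def)
  have \<Phi>a: "\<Phi> a > 1"
    using d(2)[of "min (d / 2) (1 / 2)"] d(1) by (simp add: a_def \<Phi>_def min_def split: if_splits)
  obtain \<psi> :: "'a \<Rightarrow> complex" where \<psi>: "bounded_linear \<psi>" "\<And>c x. \<psi> (c *\<^sub>C x) = c * \<psi> x"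
      "\<And>x. norm (\<psi> x) \<le> norm x" "\<psi> x0 = of_real (norm x0)"
    using hahn_banach_complex[of x0] by blast
  define f where "f x = (of_real a - \<psi> x) / (1 - of_real a * \<psi> x)" for x
  define P where "P j x = (if j = 0 then of_real a else - of_real ((1 - a\<^sup>2) * a ^ (j - 1)) * \<psi> x ^ j)" for j x
  define \<mu> where "\<mu> n x = \<psi> x ^ (n - 1) *\<^sub>C x" for n x
  \<comment> \<open>On the ray through \<open>x0\<close> the functional equals the norm, so
    \<open>\<psi> (\<mu> n z) = R ^ n\<close> and the Schwarz bound is attained.\<close>
  define z where "z = of_real (R / norm x0) *\<^sub>C x0"
  have f_moebius: "f x = - Moebius_function 0 (of_real a) (\<psi> x)" for x
    by (simp add: f_def Moebius_function_simple minus_divide_left)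
  have data: "bohr_data f P \<mu>"
    unfolding bohr_data_def
  proof (intro conjI allI impI)
    show "holomorphic_map_on f (ball 0 1)"
      unfolding f_moebius
      by (rule holomorphic_map_on_compose_functional[OF \<psi>(1,2) _ \<psi>(3)])
         (use a in \<open>auto intro!: holomorphic_intros Moebius_function_holomorphic\<close>)
    show "f ` ball 0 1 \<subseteq> ball 0 1"
    proof (clarsimp simp: f_moebius)
      fix x :: 'a assume "norm x < 1"
      then have "norm (\<psi> x) < 1" using \<psi>(3)[of x] by simp
      then show "norm (Moebius_function 0 (of_real a) (\<psi> x)) < 1"
        by (intro Moebius_function_norm_lt_1) (use a in auto)
    qed
    show "homogeneous_expansion f P"
      using moebius_expansion[OF \<psi>(1,2,3), of a] a unfolding f_def P_def by simp
    fix n :: nat assume n: "1 \<le> n"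
    show "schwarz_mapping (\<mu> n)"
      unfolding \<mu>_def by (rule power_scaleC_schwarz_mapping[OF \<psi>(1,2,3)])
    show "zero_of_order (\<mu> n) n"
      unfolding \<mu>_def by (rule power_scaleC_zero_of_order[OF \<psi>(1,2) _ n, of x0]) (use x0 \<psi>(4) in simp)
  qed
  have z: "norm z = R" "\<psi> z = of_real R"
    using x0 R by (auto simp: z_def norm_scaleC \<psi>(2,4) norm_divide)
  have \<psi>\<mu>: "\<psi> (\<mu> n z) = of_real (R ^ n)" if "n \<ge> 1" for n
    using that by (cases n) (auto simp: \<mu>_def \<psi>(2) z)
  have f0: "f 0 = of_real a"
    using linear_0[OF bounded_linear.linear[OF \<psi>(1)]] by (simp add: f_def)
  have a2: "0 < 1 - a\<^sup>2" using a by (simp add: power_less_one_iff)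
  have nP: "norm (P (Suc j) (\<mu> k z)) = (1 - a\<^sup>2) * \<rho> * (a * \<rho>) ^ j" for j
    using a a2 \<rho> by (simp add: P_def \<psi>\<mu>[OF k] \<rho>_def[symmetric] norm_mult norm_power power_mult_distrib
        mult_ac abs_mult del: of_real_diff of_real_mult of_real_power)
  have a\<rho>: "0 \<le> a * \<rho>" "a * \<rho> < 1" "a * \<tau> < 1"
    using a \<rho> \<tau> mult_strict_mono[of a 1 \<rho> 1] mult_strict_mono[of a 1 \<tau> 1] by auto
  have sums: "(\<lambda>j. norm (P (Suc j) (\<mu> k z))) sums ((1 - a\<^sup>2) * (\<rho> / (1 - a * \<rho>)))"
    unfolding nP using sums_mult[OF geometric_sums[of "a * \<rho>"], of "(1 - a\<^sup>2) * \<rho>"] a\<rho> by simp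
  have sq: "summable (\<lambda>j. (norm (P (Suc j) (\<mu> k z)))\<^sup>2)"
  proof -
    have "(norm (P (Suc j) (\<mu> k z)))\<^sup>2 = ((1 - a\<^sup>2) * \<rho>)\<^sup>2 * ((a * \<rho>)\<^sup>2) ^ j" for j
      unfolding nP by (simp add: power_mult_distrib power_mult[symmetric] mult.commute)
    moreover have "(a * \<rho>)\<^sup>2 < 1" using a\<rho> by (simp add: power_less_one_iff)
    ultimately show ?thesis by (simp add: summable_mult summable_geometric)
  qed
  have "f (\<mu> m z) - f 0 = of_real (- ((1 - a\<^sup>2) * (\<tau> / (1 - a * \<tau>))))"
  proof -
    have "f (\<mu> m z) - f 0 = of_real ((a - \<tau>) / (1 - a * \<tau>) - a)"
      by (simp add: f0 f_def[of "\<mu> m z"] \<psi>\<mu>[OF m] \<tau>_def)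
    also have "(a - \<tau>) / (1 - a * \<tau>) - a = - ((1 - a\<^sup>2) * (\<tau> / (1 - a * \<tau>)))"
      using a\<rho>(3) by (simp add: field_simps power2_eq_square)
    finally show ?thesis .
  qed
  then have fm: "norm (f (\<mu> m z) - f 0) = (1 - a\<^sup>2) * (\<tau> / (1 - a * \<tau>))"
    using a2 \<tau> a\<rho>(3) by (simp only: norm_of_real) simp
  have "0 \<le> (1 / (1 + a) + \<rho> / (1 - \<rho>)) * (\<Sum>j. (norm (P (Suc j) (\<mu> k z)))\<^sup>2)"
    using a \<rho> by (intro mult_nonneg_nonneg suminf_nonneg sq) auto
  moreover have "norm (f 0) = a" using a by (simp add: f0)
  ultimately have "\<Phi> a \<le> bohr_G p k m f P \<mu> z"
    using sums_unique[OF sums] fm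
    unfolding bohr_G_def Let_def \<Phi>_def z(1) \<rho>_def[symmetric] by (simp add: algebra_simps)
  then have "bohr_G p k m f P \<mu> z > 1" using \<Phi>a by simp
  moreover have "bohr_G_converges k P \<mu> z"
    using sums sq by (simp add: bohr_G_converges_def sums_iff)
  ultimately show ?thesis
    using data z R by (intro exI[of _ f] exI[of _ P] exI[of _ \<mu>] exI[of _ z]) simp
qed

theorem theorem7:
  fixes p :: real and k m :: nat
  assumes "\<exists>x::'a::complex_banach. x \<noteq> 0"
    and "k \<ge> 1" and "m \<ge> 1"
    and "0 < p" and "p \<le> 2"
  shows "(\<exists>!r. is_bohr_root p k m r) \<and>
    (\<forall>(f :: 'a \<Rightarrow> complex) P \<mu> z.
       bohr_data f P \<mu> \<longrightarrow> z \<in> ball 0 1 \<longrightarrow> norm z \<le> bohr_radius p k m \<longrightarrow>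
       bohr_G_converges k P \<mu> z \<and> bohr_G p k m f P \<mu> z \<le> 1) \<and>
    (\<forall>R. bohr_radius p k m < R \<longrightarrow> R < 1 \<longrightarrow>
       (\<exists>(f :: 'a \<Rightarrow> complex) P \<mu> z.
          bohr_data f P \<mu> \<and> z \<in> ball 0 1 \<and> norm z \<le> R \<and>
          bohr_G_converges k P \<mu> z \<and> bohr_G p k m f P \<mu> z > 1))"
proof (intro conjI)
  note km = assms(2,3) and p = assms(4,5)
  show ex1: "\<exists>!r. is_bohr_root p k m r" by (rule ex1_bohr_root[OF km p])
  \<comment> \<open>Unique existence makes the \<open>THE\<close> term denote the root; from here on
    only its equation is used.\<close>
  have root: "is_bohr_root p k m (bohr_radius p k m)"
    unfolding bohr_radius_def by (rule theI'[OF ex1])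
  show "\<forall>(f :: 'a \<Rightarrow> complex) P \<mu> z.
       bohr_data f P \<mu> \<longrightarrow> z \<in> ball 0 1 \<longrightarrow> norm z \<le> bohr_radius p k m \<longrightarrow>
       bohr_G_converges k P \<mu> z \<and> bohr_G p k m f P \<mu> z \<le> 1"
    using bohr_inequality[OF km p _ _ root] by blast
  obtain x0 :: 'a where x0: "x0 \<noteq> 0" using assms(1) by blast
  show "\<forall>R. bohr_radius p k m < R \<longrightarrow> R < 1 \<longrightarrow>
       (\<exists>(f :: 'a \<Rightarrow> complex) P \<mu> z.
          bohr_data f P \<mu> \<and> z \<in> ball 0 1 \<and> norm z \<le> R \<and>
          bohr_G_converges k P \<mu> z \<and> bohr_G p k m f P \<mu> z > 1)"
  proof (intro allI impI)
    fix R assume R: "bohr_radius p k m < R" "R < 1"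
    have r0: "0 \<le> bohr_radius p k m" using root by (simp add: is_bohr_root_def)
    have "p / 2 < R ^ k / (1 - R ^ k) + R ^ m / (1 - R ^ m)"
      using div_one_minus_power_strict_mono[OF r0 R km(1)]
        div_one_minus_power_strict_mono[OF r0 R km(2)] root
      unfolding is_bohr_root_def by linarith
    with r0 R show "\<exists>(f :: 'a \<Rightarrow> complex) P \<mu> z.
          bohr_data f P \<mu> \<and> z \<in> ball 0 1 \<and> norm z \<le> R \<and>
          bohr_G_converges k P \<mu> z \<and> bohr_G p k m f P \<mu> z > 1"
      by (intro bohr_sharp[OF x0 km]) auto
  qed
qed

end
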